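(* Suppose that $\delta>2\alpha_1+\beta_1$ and $\delta\ge1$. Let $f_0:\mathbb{N}\to[0,\infty)$ satisfy $m_\kappa\langle f_0\rangle<\infty$ for a fixed $\kappa>\max\{\delta,1,2-\alpha_1-\beta_1\}$, and let $f(t)$ be the solution of the discrete equation $\frac{\partial f}{\partial t}=O[f]$ with initial data $f_0$. Then for all sufficiently small $\lambda>0$, with the smallness threshold depending only on $m_1\langle f_0\rangle,\alpha_1,\beta_1,\delta$, the solution satisfies, for all $t\in[0,1]$, $$\sum_{i=1}^\infty f_i(t)\,ih\,e^{\lambda t^{1/\lfloor\delta\rfloor}\,ih}\le\frac{1}{2\lambda},$$ and for all $t\in[1,\infty)$, $$\sum_{i=1}^\infty f_i(t)\,ih\,e^{\lambda\,ih}\le\frac{1}{2\lambda}.$$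
   Context: $\mathbb{N}=\{1,2,3,\dots\}$. Fix a mesh size $h>0$ and positive real parameters $\alpha_n,\beta_n$ ($n\in\{1,2,3\}$) and $\delta$ with $\delta>\max_{n\in\{1,2,3\}}(\alpha_n+\beta_n)$ and $\delta>2\alpha_1+\beta_1-1$. For $x,y\ge 0$ let $K_n(x,y)=x^{\alpha_n}y^{\alpha_n}(x+y)^{\beta_n}$ and $\gamma(x)=x^\delta$. For $f:\mathbb{N}\to\mathbb{R}$ and $i\in\mathbb{N}$ set $$S^{(1)}_i[f]=\sum_{j=1}^{i-1}K_1(jh,(i-j)h)f_jf_{i-j}-2\sum_{j=1}^\infty K_1(ih,jh)f_if_j,$$ and for $n\in\{2,3\}$ $$S^{(n)}_i[f]=-\sum_{j=1}^{i-1}K_n((i-j)h,jh)f_if_j+\sum_{j=i+1}^\infty K_n((j-i)h,ih)f_if_j+\sum_{j=i+1}^\infty K_n(ih,(j-i)h)f_jf_{j-i},$$ $V_i[f]=\gamma(ih)f_i$, $S[f]=S^{(1)}[f]+S^{(2)}[f]+S^{(3)}[f]$, and $O[f]=S[f]-V[f]$. The moments are $m_k\langle f\rangle=\sum_{i=1}^\infty f_i\,(ih)^k$, $k\ge 0$. For $k>\max\{1,2-\alpha_1-\beta_1\}$ and $x\ge0$ define $$\mathcal{B}_k(x)=\Bigl(2\,\mathcal{C}_k\,x^{1+\frac{\delta+k-1}{\delta-2\alpha_1-\beta_1+1}+\frac{\delta}{k-1}}\Bigr)^{\frac{k-1}{\delta+k-1}},$$ where $\mathcal{C}_k$ is the positive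 constant $$\mathcal{C}_k=\frac{\delta-2\alpha_1-\beta_1+1}{\delta+k-1}\bigl[2^{\beta_1+1}(2^k-2)\bigr]^{\frac{\delta+k-1}{\delta-2\alpha_1-\beta_1+1}}\Bigl(\frac{2(2\alpha_1+\beta_1+k-2)}{\delta+k-1}\Bigr)^{\frac{2\alpha_1+\beta_1+k-2}{\delta-2\alpha_1-\beta_1+1}}.$$ "The solution" with initial datum $f_0$ means the global classical solution $f\in C^1([0,\infty);\ell^1(\mathbb{N}))$ of $\frac{\partial f}{\partial t}=O[f]$, $f(0)=f_0$, which for all $t\ge0$ satisfies $f(t,i)\ge0$, $m_1\langle f(t)\rangle\le m_1\langle f_0\rangle$ and $m_\kappa\langle f(t)\rangle\le\max\{m_\kappa\langle f_0\rangle,2\mathcal{B}_\kappa(m_1\langle f_0\rangle)\}$ (the paper's well-posedness theorem gives existence and uniqueness). *)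

theory Defs
  imports "HOL-Analysis.Analysis"
begin

text \<open>
  Sequences over the positive integers are functions of type \<^typ>\<open>nat \<Rightarrow> real\<close> of which only the
  values at indices \<open>i \<ge> 1\<close> are ever used.  The coefficients \<open>\<alpha>\<^sub>n, \<beta>\<^sub>n\<close> are \<open>\<alpha> n, \<beta> n\<close>
  for \<open>n \<in> {1, 2, 3}\<close>; other values of \<open>\<alpha>, \<beta>\<close> are irrelevant.
\<close>

definition admissible :: "real \<Rightarrow> (nat \<Rightarrow> real) \<Rightarrow> (nat \<Rightarrow> real) \<Rightarrow> real \<Rightarrow> bool" where
  "admissible h \<alpha> \<beta> \<delta> \<longleftrightarrow>
     0 < h \<and> 0 < \<delta> \<and>
     (\<forall>n\<in>{1, 2, 3}. 0 < \<alpha> n \<and> 0 < \<beta> n) \<and>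
     \<delta> > Max ((\<lambda>n. \<alpha> n + \<beta> n) ` {1, 2, 3}) \<and>
     \<delta> > 2 * \<alpha> 1 + \<beta> 1 - 1"

definition kern :: "real \<Rightarrow> real \<Rightarrow> real \<Rightarrow> real \<Rightarrow> real" where
  "kern a b x y = x powr a * y powr a * (x + y) powr b"

text \<open>
  The infinite sums below are unconditional sums of reals (with value \<open>0\<close> if divergent).  For
  nonnegative \<open>f\<close> with a finite moment of some order \<open>\<kappa> > \<delta> > \<alpha> n + \<beta> n\<close>, as in
  \<open>solution\<close> below, all of them converge.
\<close>

definition coag ::
  "real \<Rightarrow> (nat \<Rightarrow> real) \<Rightarrow> (nat \<Rightarrow> real) \<Rightarrow> (nat \<Rightarrow> real) \<Rightarrow> nat \<Rightarrow> real" where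
  "coag h \<alpha> \<beta> f i =
     (\<Sum>j=1..<i. kern (\<alpha> 1) (\<beta> 1) (real j * h) (real (i - j) * h) * f j * f (i - j))
     - 2 * (\<Sum>\<^sub>\<infinity>j\<in>{1..}. kern (\<alpha> 1) (\<beta> 1) (real i * h) (real j * h) * f i * f j)"

definition frag ::
  "nat \<Rightarrow> real \<Rightarrow> (nat \<Rightarrow> real) \<Rightarrow> (nat \<Rightarrow> real) \<Rightarrow> (nat \<Rightarrow> real) \<Rightarrow> nat \<Rightarrow> real" where
  "frag n h \<alpha> \<beta> f i =
     - (\<Sum>j=1..<i. kern (\<alpha> n) (\<beta> n) (real (i - j) * h) (real j * h) * f i * f j)
     + (\<Sum>\<^sub>\<infinity>j\<in>{i+1..}. kern (\<alpha> n) (\<beta> n) (real (j - i) * h) (real i * h) * f i * f j)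
     + (\<Sum>\<^sub>\<infinity>j\<in>{i+1..}. kern (\<alpha> n) (\<beta> n) (real i * h) (real (j - i) * h) * f j * f (j - i))"

definition damp :: "real \<Rightarrow> real \<Rightarrow> (nat \<Rightarrow> real) \<Rightarrow> nat \<Rightarrow> real" where
  "damp h \<delta> f i = (real i * h) powr \<delta> * f i"

definition rhs ::
  "real \<Rightarrow> (nat \<Rightarrow> real) \<Rightarrow> (nat \<Rightarrow> real) \<Rightarrow> real \<Rightarrow> (nat \<Rightarrow> real) \<Rightarrow> nat \<Rightarrow> real" where
  "rhs h \<alpha> \<beta> \<delta> f i =
     coag h \<alpha> \<beta> f i + frag 2 h \<alpha> \<beta> f i + frag 3 h \<alpha> \<beta> f i - damp h \<delta> f i"

definition moment :: "real \<Rightarrow> real \<Rightarrow> (nat \<Rightarrow> real) \<Rightarrow> real" where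
  "moment h k f = (\<Sum>\<^sub>\<infinity>i\<in>{1..}. f i * (real i * h) powr k)"

definition finite_moment :: "real \<Rightarrow> real \<Rightarrow> (nat \<Rightarrow> real) \<Rightarrow> bool" where
  "finite_moment h k f \<longleftrightarrow> (\<lambda>i. f i * (real i * h) powr k) summable_on {1..}"

definition C_const :: "(nat \<Rightarrow> real) \<Rightarrow> (nat \<Rightarrow> real) \<Rightarrow> real \<Rightarrow> real \<Rightarrow> real" where
  "C_const \<alpha> \<beta> \<delta> k =
     (\<delta> - 2 * \<alpha> 1 - \<beta> 1 + 1) / (\<delta> + k - 1)
     * (2 powr (\<beta> 1 + 1) * (2 powr k - 2)) powr ((\<delta> + k - 1) / (\<delta> - 2 * \<alpha> 1 - \<beta> 1 + 1))
     * (2 * (2 * \<alpha> 1 + \<beta> 1 + k - 2) / (\<delta> + k - 1))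
         powr ((2 * \<alpha> 1 + \<beta> 1 + k - 2) / (\<delta> - 2 * \<alpha> 1 - \<beta> 1 + 1))"

definition B_bound :: "(nat \<Rightarrow> real) \<Rightarrow> (nat \<Rightarrow> real) \<Rightarrow> real \<Rightarrow> real \<Rightarrow> real \<Rightarrow> real" where
  "B_bound \<alpha> \<beta> \<delta> k x =
     (2 * C_const \<alpha> \<beta> \<delta> k
        * x powr (1 + (\<delta> + k - 1) / (\<delta> - 2 * \<alpha> 1 - \<beta> 1 + 1) + \<delta> / (k - 1)))
     powr ((k - 1) / (\<delta> + k - 1))"

definition in_l1 :: "(nat \<Rightarrow> real) \<Rightarrow> bool" where
  "in_l1 u \<longleftrightarrow> (\<lambda>i. \<bar>u i\<bar>) summable_on {1..}"

definition l1_norm :: "(nat \<Rightarrow> real) \<Rightarrow> real" where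
  "l1_norm u = (\<Sum>\<^sub>\<infinity>i\<in>{1..}. \<bar>u i\<bar>)"

text \<open>
  \<open>f\<close> belongs to \<open>C\<^sup>1([0,\<infinity>); l\<^sup>1)\<close> with derivative \<open>g\<close>: difference quotients converge in the norm
  of \<open>l\<^sup>1\<close> (one-sidedly at \<open>t = 0\<close>), and \<open>g\<close> is continuous into \<open>l\<^sup>1\<close>.
\<close>

definition l1_C1_deriv :: "(real \<Rightarrow> nat \<Rightarrow> real) \<Rightarrow> (real \<Rightarrow> nat \<Rightarrow> real) \<Rightarrow> bool" where
  "l1_C1_deriv f g \<longleftrightarrow>
     (\<forall>t\<ge>0. in_l1 (f t) \<and> in_l1 (g t) \<and>
        ((\<lambda>s. l1_norm (\<lambda>i. (f s i - f t i) / (s - t) - g t i)) \<longlongrightarrow> 0) (at t within {0..}) \<and>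
        ((\<lambda>s. l1_norm (\<lambda>i. g s i - g t i)) \<longlongrightarrow> 0) (at t within {0..}))"

definition solution ::
  "real \<Rightarrow> (nat \<Rightarrow> real) \<Rightarrow> (nat \<Rightarrow> real) \<Rightarrow> real \<Rightarrow> real \<Rightarrow> (nat \<Rightarrow> real) \<Rightarrow>
   (real \<Rightarrow> nat \<Rightarrow> real) \<Rightarrow> bool" where
  "solution h \<alpha> \<beta> \<delta> \<kappa> f0 f \<longleftrightarrow>
     l1_C1_deriv f (\<lambda>t. rhs h \<alpha> \<beta> \<delta> (f t)) \<and>
     (\<forall>i\<ge>1. f 0 i = f0 i) \<and>
     (\<forall>t\<ge>0.
        (\<forall>i\<ge>1. 0 \<le> f t i) \<and>
        finite_moment h 1 (f t) \<and> moment h 1 (f t) \<le> moment h 1 f0 \<and>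
        finite_moment h \<kappa> (f t) \<and>
        moment h \<kappa> (f t) \<le> max (moment h \<kappa> f0) (2 * B_bound \<alpha> \<beta> \<delta> \<kappa> (moment h 1 f0)))"

end

theory Submission
  imports Defs
begin

text \<open>
  The weight \<open>w(t,x) = exp ((1 + (\<lambda>x)\<^sup>\<delta> t)\<^bsup>1/\<delta>\<^esup>)\<close> dominates \<open>exp (\<lambda> t\<^bsup>1/\<delta>\<^esup> x)\<close>, equals the constant
  \<open>e\<close> at \<open>t = 0\<close>, and for small \<open>\<lambda>\<close> satisfies \<open>\<partial>\<^sub>t w \<le> x\<^sup>\<delta> w / 4\<close>, so that the damping absorbs its growth in time up to the
  initial instant, which \<open>exp (\<lambda> t\<^bsup>1/\<delta>\<^esup> x)\<close> itself does not allow.  Since \<open>x w(t,x)\<close> is superadditive,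
  fragmentation does not increase \<open>\<Phi>(t) = \<Sum> f\<^sub>i x\<^sub>i w(t,x\<^sub>i)\<close>; coagulation contributes at most
  \<open>2\<^bsup>\<beta>+2\<^esup> \<lambda> \<Phi> \<Sum> f\<^sub>i x\<^sub>i\<^bsup>1+p\<^esup> w(t,x\<^sub>i)\<close> with \<open>p = 2\<alpha> + \<beta> < \<delta>\<close>, and as long as \<open>\<lambda> \<Phi> \<le> 1/2\<close> the damping controls this
  sum up to a multiple of \<open>\<Phi>\<close>.  A continuity argument then keeps \<open>\<Phi>\<close> below \<open>1/(2\<lambda>)\<close> on a time interval of
  length one, provided \<open>\<lambda>\<close> is small compared with the first moment at its start.  The first moment never exceeds
  its initial value, so the argument may be restarted at time \<open>T - 1\<close> for every \<open>T \<ge> 1\<close>.  Finiteness of \<open>\<Phi>\<close>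
  is not known beforehand; the estimates are made for bounded truncations of the weight.
\<close>

section \<open>Weak form of the equation\<close>

lemma summable_on_mult_bounded:
  fixes f b :: "'a \<Rightarrow> real"
  assumes "f summable_on A" "\<And>x. x \<in> A \<Longrightarrow> \<bar>b x\<bar> \<le> B"
  shows "(\<lambda>x. f x * b x) summable_on A"
proof -
  have "(\<lambda>x. norm (f x) * B) summable_on A"
    by (intro summable_on_cmult_left summable_on_iff_abs_summable_on_real[THEN iffD1] assms(1))
  then have "(\<lambda>x. norm (f x * b x)) summable_on A"
    by (rule Infinite_Sum.abs_summable_on_comparison_test')
      (use assms(2) in \<open>auto simp: abs_mult intro!: mult_left_mono\<close>)
  then show ?thesis
    by (rule Infinite_Sum.abs_summable_summable)
qed

text \<open>Tonelli's principle: for nonnegative terms, convergence of the iterated sums already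
  gives summability over the product.\<close>

lemma has_sum_product_nonneg:
  fixes u :: "'a \<Rightarrow> real" and v :: "'b \<Rightarrow> real"
  assumes "(u has_sum s) A" "(v has_sum t) B"
    and "\<And>x. x \<in> A \<Longrightarrow> 0 \<le> u x" "\<And>y. y \<in> B \<Longrightarrow> 0 \<le> v y"
  shows "((\<lambda>(x, y). u x * v y) has_sum s * t) (A \<times> B)"
proof (rule has_sum_SigmaI)
  show 1: "((\<lambda>y. case (x, y) of (x, y) \<Rightarrow> u x * v y) has_sum u x * t) B" if "x \<in> A" for x
    using has_sum_cmult_right[OF assms(2)] by simp
  show 2: "((\<lambda>x. u x * t) has_sum s * t) A"
    by (rule has_sum_cmult_left[OF assms(1)])
  show "(\<lambda>(x, y). u x * v y) summable_on A \<times> B"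
    by (rule summable_on_SigmaI[OF 1]) (use 2 assms in \<open>auto simp: has_sum_imp_summable\<close>)
qed

text \<open>A pair \<open>(j, k)\<close> stands for a particle of size \<open>j\<close> that meets
  one of size \<open>k\<close> and splits into pieces of sizes \<open>k\<close> and
  \<open>j - k\<close>.\<close>

abbreviation subpairs :: "(nat \<times> nat) set" where
  "subpairs \<equiv> {(j, k). 1 \<le> k \<and> k < j}"

text \<open>Pairs are regrouped along the antidiagonals \<open>j + k = i\<close>. This matches the
  gain term of \<open>coag\<close>.\<close>

lemma has_sum_convolution:
  fixes F :: "nat \<Rightarrow> nat \<Rightarrow> real"
  assumes "((\<lambda>(j, k). F j k) has_sum s) ({1..} \<times> {1..})"
  shows "((\<lambda>i. \<Sum>j=1..<i. F j (i - j)) has_sum s) {1..}"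
proof -
  have "((\<lambda>(i, j). F j (i - j)) has_sum s) (SIGMA i:{1..}. {1..<i})
      \<longleftrightarrow> ((\<lambda>(j, k). F j k) has_sum s) ({1..} \<times> {1..})"
    by (rule has_sum_reindex_bij_witness[where j = "\<lambda>(i, j). (j, i - j)" and i = "\<lambda>(j, k). (j + k, j)"])
      auto
  with assms have "((\<lambda>(i, j). F j (i - j)) has_sum s) (SIGMA i:{1..}. {1..<i})"
    by simp
  then show ?thesis
    by (rule has_sum_SigmaD) (simp add: has_sum_finiteI)
qed

text \<open>The three sums in \<open>frag\<close> run over the same splitting events, grouped by the
  parent size \<open>j\<close>, by the piece \<open>k\<close>, and by the other piece
  \<open>j - k\<close>.\<close>

lemma has_sum_subpairs:
  fixes F :: "nat \<Rightarrow> nat \<Rightarrow> real"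
  assumes "((\<lambda>(j, k). F j k) has_sum s) subpairs"
  shows "((\<lambda>i. \<Sum>j=1..<i. F i j) has_sum s) {1..}"
    and "((\<lambda>i. \<Sum>\<^sub>\<infinity>j\<in>{i+1..}. F j i) has_sum s) {1..}"
    and "((\<lambda>i. \<Sum>\<^sub>\<infinity>j\<in>{i+1..}. F j (j - i)) has_sum s) {1..}"
proof -
  have "subpairs = (SIGMA i:{1..}. {1..<i})"
    by auto
  with assms have "((\<lambda>(j, k). F j k) has_sum s) (SIGMA i:{1..}. {1..<i})"
    by simp
  then show "((\<lambda>i. \<Sum>j=1..<i. F i j) has_sum s) {1..}"
    by (rule has_sum_SigmaD) (simp add: has_sum_finiteI)
  have "((\<lambda>(i, j). F j i) has_sum s) (SIGMA i:{1..}. {i+1..})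
      \<longleftrightarrow> ((\<lambda>(j, k). F j k) has_sum s) subpairs"
    by (rule has_sum_reindex_bij_witness[where j = "\<lambda>(i, j). (j, i)" and i = "\<lambda>(j, k). (k, j)"]) auto
  with assms have *: "((\<lambda>(i, j). F j i) has_sum s) (SIGMA i:{1..}. {i+1..})"
    by simp
  have "(\<lambda>j. F j i) summable_on {i+1..}" if "i \<in> {1..}" for i
    using summable_on_SigmaD1[OF has_sum_imp_summable[OF *] that] .
  then show "((\<lambda>i. \<Sum>\<^sub>\<infinity>j\<in>{i+1..}. F j i) has_sum s) {1..}"
    by (intro has_sum_SigmaD[OF *]) simp
  have "((\<lambda>(i, j). F j (j - i)) has_sum s) (SIGMA i:{1..}. {i+1..})
      \<longleftrightarrow> ((\<lambda>(j, k). F j k) has_sum s) subpairs"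
    by (rule has_sum_reindex_bij_witness[where j = "\<lambda>(i, j). (j, j - i)" and i = "\<lambda>(j, k). (j - k, j)"])
      auto
  with assms have *: "((\<lambda>(i, j). F j (j - i)) has_sum s) (SIGMA i:{1..}. {i+1..})"
    by simp
  have "(\<lambda>j. F j (j - i)) summable_on {i+1..}" if "i \<in> {1..}" for i
    using summable_on_SigmaD1[OF has_sum_imp_summable[OF *] that] .
  then show "((\<lambda>i. \<Sum>\<^sub>\<infinity>j\<in>{i+1..}. F j (j - i)) has_sum s) {1..}"
    by (intro has_sum_SigmaD[OF *]) simp
qed

section \<open>Testing the collision operators against bounded sequences\<close>

lemma kern_commute: "kern a b x y = kern a b y x"
  by (simp add: kern_def ac_simps)

text \<open>A bounded test sequence keeps the three parts of the pair sum absolutely convergent, so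
  they can be rearranged separately. The factor 2 of the loss term in \<open>coag\<close> becomes
  the two terms \<open>\<phi> j\<close> and \<open>\<phi> k\<close>.\<close>

lemma coag_weak_form:
  fixes f \<phi> \<alpha> \<beta> :: "nat \<Rightarrow> real" and h :: real
  defines "K \<equiv> \<lambda>j k. kern (\<alpha> 1) (\<beta> 1) (real j * h) (real k * h) * f j * f k"
  assumes K: "(\<lambda>(j, k). K j k) summable_on {1..} \<times> {1..}"
    and \<phi>: "\<And>i. i \<ge> 1 \<Longrightarrow> \<bar>\<phi> i\<bar> \<le> B"
  shows "((\<lambda>i. coag h \<alpha> \<beta> f i * \<phi> i) has_sum
           (\<Sum>\<^sub>\<infinity>(j, k)\<in>{1..} \<times> {1..}. K j k * (\<phi> (j + k) - \<phi> j - \<phi> k))) {1..}"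
    and "(\<lambda>(j, k). K j k * (\<phi> (j + k) - \<phi> j - \<phi> k)) summable_on {1..} \<times> {1..}"
proof -
  have sum: "(\<lambda>(j, k). K j k * b j k) summable_on {1..} \<times> {1..}"
    if "\<And>j k. j \<ge> 1 \<Longrightarrow> k \<ge> 1 \<Longrightarrow> \<bar>b j k\<bar> \<le> B" for b :: "nat \<Rightarrow> nat \<Rightarrow> real"
    using summable_on_mult_bounded[OF K, of "\<lambda>(j, k). b j k" B] that by (auto simp: split_def)
  obtain s1 where s1: "((\<lambda>(j, k). K j k * \<phi> (j + k)) has_sum s1) ({1..} \<times> {1..})"
    using sum[of "\<lambda>j k. \<phi> (j + k)"] \<phi> by (auto simp: summable_on_def)
  obtain s2 where s2: "((\<lambda>(j, k). K j k * \<phi> j) has_sum s2) ({1..} \<times> {1..})"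
    using sum[of "\<lambda>j k. \<phi> j"] \<phi> by (auto simp: summable_on_def)
  \<comment> \<open>Swapping the two sizes and using the symmetry of the kernel shows that the
    \<open>\<phi> k\<close> part has the same value \<open>s2\<close>.\<close>
  have "((\<lambda>(j, k). K j k * \<phi> k) has_sum s2) ({1..} \<times> {1..})
      \<longleftrightarrow> ((\<lambda>(j, k). K j k * \<phi> j) has_sum s2) ({1..} \<times> {1..})"
    by (rule has_sum_reindex_bij_witness[where j = prod.swap and i = prod.swap])
      (auto simp: K_def kern_commute)
  with s2 have s3: "((\<lambda>(j, k). K j k * \<phi> k) has_sum s2) ({1..} \<times> {1..})"
    by simp
  have pair: "((\<lambda>(j, k). K j k * (\<phi> (j + k) - \<phi> j - \<phi> k)) has_sum s1 + - s2 + - s2)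
      ({1..} \<times> {1..})"
    using has_sum_add[OF has_sum_add[OF s1 has_sum_uminusI[OF s2]] has_sum_uminusI[OF s3]]
    by (simp add: split_def algebra_simps)
  have gain: "((\<lambda>i. \<Sum>j=1..<i. K j (i - j) * \<phi> (j + (i - j))) has_sum s1) {1..}"
    by (rule has_sum_convolution[OF s1])
  have "(\<lambda>k. K j k * \<phi> j) summable_on {1..}" if "j \<in> {1..}" for j
    using summable_on_SigmaD1[OF has_sum_imp_summable[OF s2] that] .
  then have loss: "((\<lambda>j. \<Sum>\<^sub>\<infinity>k\<in>{1..}. K j k * \<phi> j) has_sum s2) {1..}"
    by (intro has_sum_SigmaD[OF s2]) simp
  have "((\<lambda>i. (\<Sum>j=1..<i. K j (i - j) * \<phi> (j + (i - j)))
      + - (\<Sum>\<^sub>\<infinity>k\<in>{1..}. K i k * \<phi> i) + - (\<Sum>\<^sub>\<infinity>k\<in>{1..}. K i k * \<phi> i)) has_sum s1 + - s2 + - s2) {1..}"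
    by (intro has_sum_add gain has_sum_uminusI loss)
  also have "?this \<longleftrightarrow> ((\<lambda>i. coag h \<alpha> \<beta> f i * \<phi> i) has_sum s1 + - s2 + - s2) {1..}"
    by (intro has_sum_cong)
      (simp add: coag_def K_def infsum_cmult_right' sum_distrib_left sum_distrib_right algebra_simps)
  finally show "((\<lambda>i. coag h \<alpha> \<beta> f i * \<phi> i) has_sum
           (\<Sum>\<^sub>\<infinity>(j, k)\<in>{1..} \<times> {1..}. K j k * (\<phi> (j + k) - \<phi> j - \<phi> k))) {1..}"
    using infsumI[OF pair] by simp
  show "(\<lambda>(j, k). K j k * (\<phi> (j + k) - \<phi> j - \<phi> k)) summable_on {1..} \<times> {1..}"
    using pair by (rule has_sum_imp_summable)
qed

text \<open>Each splitting event removes the parent \<open>j\<close> and creates \<open>k\<close>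
  and \<open>j - k\<close>. The size-\<open>k\<close> collision partner survives, so it contributes
  nothing to the balance.\<close>

lemma frag_weak_form:
  fixes f \<phi> \<alpha> \<beta> :: "nat \<Rightarrow> real" and h :: real
  defines "K \<equiv> \<lambda>n j k. kern (\<alpha> n) (\<beta> n) (real (j - k) * h) (real k * h) * f j * f k"
  assumes K: "(\<lambda>(j, k). K n j k) summable_on subpairs"
    and \<phi>: "\<And>i. i \<ge> 1 \<Longrightarrow> \<bar>\<phi> i\<bar> \<le> B"
  shows "((\<lambda>i. frag n h \<alpha> \<beta> f i * \<phi> i) has_sum
           (\<Sum>\<^sub>\<infinity>(j, k)\<in>subpairs. K n j k * (\<phi> (j - k) + \<phi> k - \<phi> j))) {1..}"
    and "(\<lambda>(j, k). K n j k * (\<phi> (j - k) + \<phi> k - \<phi> j)) summable_on subpairs"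
proof -
  have sum: "(\<lambda>(j, k). K n j k * b j k) summable_on subpairs"
    if "\<And>j k. k \<ge> 1 \<Longrightarrow> k < j \<Longrightarrow> \<bar>b j k\<bar> \<le> B" for b :: "nat \<Rightarrow> nat \<Rightarrow> real"
    using summable_on_mult_bounded[OF K, of "\<lambda>(j, k). b j k" B] that by (auto simp: split_def)
  obtain s1 where s1: "((\<lambda>(j, k). K n j k * \<phi> j) has_sum s1) subpairs"
    using sum[of "\<lambda>j k. \<phi> j"] \<phi> by (auto simp: summable_on_def)
  obtain s2 where s2: "((\<lambda>(j, k). K n j k * \<phi> k) has_sum s2) subpairs"
    using sum[of "\<lambda>j k. \<phi> k"] \<phi> by (auto simp: summable_on_def)
  obtain s3 where s3: "((\<lambda>(j, k). K n j k * \<phi> (j - k)) has_sum s3) subpairs"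
    using sum[of "\<lambda>j k. \<phi> (j - k)"] \<phi> by (auto simp: summable_on_def)
  have pair: "((\<lambda>(j, k). K n j k * (\<phi> (j - k) + \<phi> k - \<phi> j)) has_sum - s1 + s2 + s3) subpairs"
    using has_sum_add[OF has_sum_add[OF has_sum_uminusI[OF s1] s2] s3]
    by (simp add: split_def algebra_simps)
  have "((\<lambda>i. - (\<Sum>j=1..<i. K n i j * \<phi> i) + (\<Sum>\<^sub>\<infinity>j\<in>{i+1..}. K n j i * \<phi> i)
      + (\<Sum>\<^sub>\<infinity>j\<in>{i+1..}. K n j (j - i) * \<phi> (j - (j - i)))) has_sum - s1 + s2 + s3) {1..}"
    by (intro has_sum_add has_sum_uminusI has_sum_subpairs(1)[OF s1] has_sum_subpairs(2)[OF s2]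
        has_sum_subpairs(3)[OF s3])
  also have "?this \<longleftrightarrow> ((\<lambda>i. frag n h \<alpha> \<beta> f i * \<phi> i) has_sum - s1 + s2 + s3) {1..}"
  proof (intro has_sum_cong)
    fix i :: nat assume "i \<in> {1..}"
    \<comment> \<open>With \<open>k = j - i\<close> the other piece is
      \<open>j - (j - i) = i\<close>, which recovers the third sum in \<open>frag\<close>.\<close>
    have 1: "(\<Sum>\<^sub>\<infinity>j\<in>{i+1..}. K n j (j - i) * \<phi> (j - (j - i)))
        = (\<Sum>\<^sub>\<infinity>j\<in>{i+1..}. kern (\<alpha> n) (\<beta> n) (real i * h) (real (j - i) * h) * f j * f (j - i) * \<phi> i)"
      by (intro infsum_cong) (simp add: K_def)
    have 2: "(\<Sum>\<^sub>\<infinity>j\<in>{i+1..}. K n j i * \<phi> i)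
        = (\<Sum>\<^sub>\<infinity>j\<in>{i+1..}. kern (\<alpha> n) (\<beta> n) (real (j - i) * h) (real i * h) * f i * f j * \<phi> i)"
      by (intro infsum_cong) (simp add: K_def)
    show "- (\<Sum>j=1..<i. K n i j * \<phi> i) + (\<Sum>\<^sub>\<infinity>j\<in>{i+1..}. K n j i * \<phi> i)
      + (\<Sum>\<^sub>\<infinity>j\<in>{i+1..}. K n j (j - i) * \<phi> (j - (j - i))) = frag n h \<alpha> \<beta> f i * \<phi> i"
      unfolding 1 2 infsum_cmult_left'
      by (simp add: frag_def K_def sum_distrib_left sum_distrib_right algebra_simps)
  qed
  finally show "((\<lambda>i. frag n h \<alpha> \<beta> f i * \<phi> i) has_sum
           (\<Sum>\<^sub>\<infinity>(j, k)\<in>subpairs. K n j k * (\<phi> (j - k) + \<phi> k - \<phi> j))) {1..}"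
    using infsumI[OF pair] by simp
  show "(\<lambda>(j, k). K n j k * (\<phi> (j - k) + \<phi> k - \<phi> j)) summable_on subpairs"
    using pair by (rule has_sum_imp_summable)
qed

text \<open>Pairing with a bounded sequence is a bounded linear functional on \<open>l1\<close> and
  therefore commutes with the derivative. The error of the difference quotient is at most
  \<open>B\<close> times its \<open>l1\<close> norm.\<close>

lemma l1_C1_deriv_weighted_sum:
  fixes f g :: "real \<Rightarrow> nat \<Rightarrow> real"
  assumes "l1_C1_deriv f g" "t \<ge> 0" and b: "\<And>i. i \<ge> 1 \<Longrightarrow> \<bar>b i\<bar> \<le> B"
  shows "((\<lambda>s. \<Sum>\<^sub>\<infinity>i\<in>{1..}. f s i * b i) has_real_derivative (\<Sum>\<^sub>\<infinity>i\<in>{1..}. g t i * b i))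
    (at t within {0..})"
proof -
  have in_l1: "f s summable_on {1..}" "g s summable_on {1..}" if "s \<ge> 0" for s
    using assms(1) that
    by (simp_all add: l1_C1_deriv_def in_l1_def Infinite_Sum.abs_summable_summable)
  have B: "B \<ge> 0"
    using b[of 1] by simp
  define q where "q = (\<lambda>s i. (f s i - f t i) / (s - t) - g t i)"
  have lim: "((\<lambda>s. l1_norm (q s)) \<longlongrightarrow> 0) (at t within {0..})"
    using assms(1,2) by (simp add: l1_C1_deriv_def q_def)
  have "((\<lambda>s. ((\<Sum>\<^sub>\<infinity>i\<in>{1..}. f s i * b i) - (\<Sum>\<^sub>\<infinity>i\<in>{1..}. f t i * b i)) / (s - t)
      - (\<Sum>\<^sub>\<infinity>i\<in>{1..}. g t i * b i)) \<longlongrightarrow> 0) (at t within {0..})"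
  proof (rule Lim_null_comparison)
    show "((\<lambda>s. l1_norm (q s) * B) \<longlongrightarrow> 0) (at t within {0..})"
      using tendsto_mult_right[OF lim, of B] by simp
    show "\<forall>\<^sub>F s in at t within {0..}. norm (((\<Sum>\<^sub>\<infinity>i\<in>{1..}. f s i * b i) - (\<Sum>\<^sub>\<infinity>i\<in>{1..}. f t i * b i)) / (s - t)
      - (\<Sum>\<^sub>\<infinity>i\<in>{1..}. g t i * b i)) \<le> l1_norm (q s) * B"
    proof (rule eventually_mono)
      show "\<forall>\<^sub>F s in at t within {0..}. s \<in> {0..} \<and> s \<noteq> t"
        by (auto simp: eventually_at_filter)
      fix s assume s: "s \<in> {0..} \<and> s \<noteq> t"
      have S: "f s summable_on {1..}" "f t summable_on {1..}" "g t summable_on {1..}"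
        using in_l1 s assms(2) by auto
      note hs = S[THEN summable_on_mult_bounded[of _ _ b B], THEN has_sum_infsum]
      have "((\<lambda>i. inverse (s - t) * (f s i * b i + - (f t i * b i)) + - (g t i * b i)) has_sum
        inverse (s - t) * ((\<Sum>\<^sub>\<infinity>i\<in>{1..}. f s i * b i) + - (\<Sum>\<^sub>\<infinity>i\<in>{1..}. f t i * b i))
          + - (\<Sum>\<^sub>\<infinity>i\<in>{1..}. g t i * b i)) {1..}"
        using b by (intro has_sum_add has_sum_cmult_right has_sum_uminusI hs) auto
      also have "(\<lambda>i. inverse (s - t) * (f s i * b i + - (f t i * b i)) + - (g t i * b i)) = (\<lambda>i. q s i * b i)"
        by (simp add: q_def fun_eq_iff field_simps)
      finally have 1: "((\<lambda>i. q s i * b i) has_sum ((\<Sum>\<^sub>\<infinity>i\<in>{1..}. f s i * b i)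
          - (\<Sum>\<^sub>\<infinity>i\<in>{1..}. f t i * b i)) / (s - t) - (\<Sum>\<^sub>\<infinity>i\<in>{1..}. g t i * b i)) {1..}"
        by (simp add: field_simps)
      have "(\<lambda>i. inverse (s - t) * (f s i + - (f t i)) + - g t i) summable_on {1..}"
        by (intro summable_on_add summable_on_cmult_right summable_on_uminus[THEN iffD2] S)
      also have "(\<lambda>i. inverse (s - t) * (f s i + - (f t i)) + - g t i) = q s"
        by (simp add: q_def fun_eq_iff field_simps)
      finally have "(\<lambda>i. norm (q s i)) summable_on {1..}"
        by (rule summable_on_iff_abs_summable_on_real[THEN iffD1])
      then have 2: "((\<lambda>i. \<bar>q s i\<bar> * B) has_sum l1_norm (q s) * B) {1..}"
        unfolding l1_norm_def by (intro has_sum_cmult_left) simp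
      have le: "norm (q s i * b i) \<le> \<bar>q s i\<bar> * B" if "i \<in> {1..}" for i
        using b[of i] that by (auto simp: abs_mult intro!: mult_left_mono)
      have "(\<lambda>i. norm (q s i * b i)) summable_on {1..}"
        by (rule Infinite_Sum.abs_summable_on_comparison_test'[OF has_sum_imp_summable[OF 2] le])
      then have 3: "((\<lambda>i. norm (q s i * b i)) has_sum (\<Sum>\<^sub>\<infinity>i\<in>{1..}. norm (q s i * b i))) {1..}"
        by simp
      from order_trans[OF norm_has_sum_bound[OF 3 1] has_sum_mono[OF 3 2 le]]
      show "norm (((\<Sum>\<^sub>\<infinity>i\<in>{1..}. f s i * b i) - (\<Sum>\<^sub>\<infinity>i\<in>{1..}. f t i * b i)) / (s - t)
          - (\<Sum>\<^sub>\<infinity>i\<in>{1..}. g t i * b i)) \<le> l1_norm (q s) * B"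
        by simp
    qed
  qed
  then show ?thesis
    unfolding has_field_derivative_iff by (rule LIM_zero_cancel)
qed

section \<open>The exponential weight and its truncation\<close>

definition weight :: "real \<Rightarrow> real \<Rightarrow> real \<Rightarrow> real \<Rightarrow> real" where
  "weight lam d t x = exp ((1 + t * (lam * x) powr d) powr (1 / d))"

lemma weight_0: "weight lam d 0 x = exp 1"
  by (simp add: weight_def)

lemma weight_ge_1: "1 \<le> weight lam d t x"
  by (simp add: weight_def)

lemma weight_mono:
  assumes "0 < lam" "1 \<le> d" "0 \<le> s" "s \<le> t" "0 \<le> x" "x \<le> y"
  shows "weight lam d s x \<le> weight lam d t y"
proof -
  have "(lam * x) powr d \<le> (lam * y) powr d"
    using assms by (intro powr_mono2) auto
  then have "s * (lam * x) powr d \<le> t * (lam * y) powr d"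
    using assms by (intro mult_mono) auto
  then show ?thesis
    using assms unfolding weight_def by (simp add: powr_mono2)
qed

lemma exp_le_weight:
  assumes "0 < lam" "1 \<le> d" "0 \<le> t" "0 \<le> x"
  shows "exp (lam * t powr (1 / d) * x) \<le> weight lam d t x"
proof -
  have "lam * t powr (1 / d) * x = (t * (lam * x) powr d) powr (1 / d)"
    using assms by (simp add: powr_mult powr_powr)
  also have "\<dots> \<le> (1 + t * (lam * x) powr d) powr (1 / d)"
    using assms by (intro powr_mono2) auto
  finally show ?thesis
    by (simp add: weight_def)
qed

text \<open>Convexity of the power function: for \<open>d \<ge> 1\<close> its slope is
  nondecreasing, so differences over a fixed distance grow under translation. It yields the triangle
  inequality needed for \<open>weight_add_le\<close>.\<close>

lemma powr_translate_diff_mono: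
  assumes "1 \<le> d" "0 < u" "u \<le> a" "0 \<le> v"
  shows "a powr d - u powr d \<le> (a + v) powr d - (u + v) powr (d::real)"
proof -
  have "(\<lambda>v. (a + v) powr d - (u + v) powr d) 0 \<le> (\<lambda>v. (a + v) powr d - (u + v) powr d) v"
  proof (rule DERIV_nonneg_imp_nondecreasing[OF assms(4)])
    fix z assume z: "0 \<le> z" "z \<le> v"
    have "((\<lambda>v. (a + v) powr d - (u + v) powr d) has_real_derivative
        d * (a + z) powr (d - 1) - d * (u + z) powr (d - 1)) (at z)"
      using assms z by (auto intro!: derivative_eq_intros)
    moreover have "d * (u + z) powr (d - 1) \<le> d * (a + z) powr (d - 1)"
      using assms z by (intro mult_left_mono powr_mono2) auto
    ultimately show "\<exists>y. ((\<lambda>v. (a + v) powr d - (u + v) powr d) has_real_derivative y) (at z) \<and> 0 \<le> y"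
      by fastforce
  qed
  then show ?thesis by simp
qed

text \<open>The exponent of the weight is the \<open>l\<^sup>d\<close> norm of \<open>(1, c x)\<close> with \<open>c = lam t\<^bsup>1/d\<^esup>\<close>, so it is
  Lipschitz in \<open>x\<close> with constant \<open>c\<close>.\<close>

lemma weight_add_le:
  assumes "0 < lam" "1 \<le> d" "0 \<le> t" "0 < x" "0 \<le> y"
  shows "weight lam d t (x + y) \<le> weight lam d t x * exp (lam * t powr (1 / d) * y)"
proof (cases "t = 0")
  case False
  define c where "c = lam * t powr (1 / d)"
  define a where "a = (1 + t * (lam * x) powr d) powr (1 / d)"
  have c: "0 < c"
    using False assms by (simp add: c_def)
  have cd: "t * (lam * z) powr d = (c * z) powr d" if "0 \<le> z" for z
    using assms that by (simp add: c_def powr_mult powr_powr)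
  have a: "a powr d = 1 + (c * x) powr d"
    using assms by (simp add: a_def powr_powr cd add_nonneg_nonneg)
  have "c * x = ((c * x) powr d) powr (1 / d)"
    using c assms by (simp add: powr_powr)
  also have "\<dots> \<le> a"
    using assms by (simp add: a_def cd powr_mono2)
  finally have le: "c * x \<le> a" .
  have "1 + (c * (x + y)) powr d \<le> (a + c * y) powr d"
    using powr_translate_diff_mono[OF assms(2) _ le, of "c * y"] a c assms by (simp add: algebra_simps)
  then have "(1 + (c * (x + y)) powr d) powr (1 / d) \<le> ((a + c * y) powr d) powr (1 / d)"
    using assms by (intro powr_mono2) auto
  also have "\<dots> = a + c * y"
    using c assms by (simp add: powr_powr a_def)
  finally show ?thesis
    using assms by (simp add: weight_def a_def cd flip: exp_add c_def)
qed (use assms in \<open>simp add: weight_def\<close>)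

text \<open>The bound has one factor \<open>lam\<close> and both weights, so after multiplication by
  a size it becomes a product of two weighted sizes. Restricting to \<open>t \<le> 1\<close> allows
  the Lipschitz constant of the exponent to be replaced by \<open>lam\<close>.\<close>

lemma weight_increment_le:
  assumes "0 < lam" "1 \<le> d" "0 \<le> t" "t \<le> 1" "0 < x" "0 \<le> y"
  shows "weight lam d t (x + y) - weight lam d t x \<le> lam * y * weight lam d t x * weight lam d t y"
proof -
  define u where "u = lam * t powr (1 / d) * y"
  have u: "0 \<le> u" "u \<le> lam * y"
    using assms mult_right_mono[of "lam * t powr (1 / d)" lam y]
    by (auto simp: u_def powr_le1 mult_left_le)
  \<comment> \<open>This is \<open>1 - u \<le> exp (- u)\<close> multiplied by
    \<open>exp u\<close>.\<close>
  have "exp u - 1 \<le> u * exp u"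
    using exp_ge_add_one_self[of "- u"] by (simp add: exp_minus field_simps)
  also have "\<dots> \<le> lam * y * weight lam d t y"
    using u exp_le_weight[of lam d t y] assms by (intro mult_mono) (auto simp: u_def)
  finally have "weight lam d t x * (exp u - 1) \<le> weight lam d t x * (lam * y * weight lam d t y)"
    by (intro mult_left_mono) (simp_all add: weight_def)
  then show ?thesis
    using weight_add_le[OF assms(1-3,5,6)] by (simp add: u_def algebra_simps)
qed

section \<open>Growth of the weight in time\<close>

definition weight_dt :: "real \<Rightarrow> real \<Rightarrow> real \<Rightarrow> real \<Rightarrow> real" where
  "weight_dt lam d t x =
     (1 / d) * (1 + t * (lam * x) powr d) powr (1 / d - 1) * (lam * x) powr d * weight lam d t x"

lemma weight_has_time_derivative:
  assumes "0 < lam" "1 \<le> d" "0 \<le> t" "0 \<le> x"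
  shows "((\<lambda>s. weight lam d s x) has_real_derivative weight_dt lam d t x) (at t within A)"
proof -
  have "0 < 1 + t * (lam * x) powr d"
    using assms by (simp add: add_pos_nonneg)
  then show ?thesis
    unfolding weight_def weight_dt_def using assms by (auto intro!: derivative_eq_intros)
qed

text \<open>The power with exponent \<open>1 / d - 1 \<le> 0\<close> has base at least 1, so it is
  at most 1; and \<open>lam powr d \<le> lam \<le> 1 / 4\<close> since \<open>d \<ge> 1\<close>. The
  factor \<open>1 / 4\<close> is the share of the damping reserved for the growth of the
  weight.\<close>

lemma weight_dt_le:
  assumes "0 < lam" "lam \<le> 1 / 4" "1 \<le> d" "0 \<le> t" "0 \<le> x"
  shows "weight_dt lam d t x \<le> 1 / 4 * x powr d * weight lam d t x"
proof -
  have "(1 + t * (lam * x) powr d) powr (1 / d - 1) \<le> 1 powr (1 / d - 1)"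
    using assms by (intro powr_mono2') auto
  then have "(1 / d) * (1 + t * (lam * x) powr d) powr (1 / d - 1) \<le> 1 * 1"
    using assms by (intro mult_mono) auto
  moreover have "lam powr d \<le> lam powr 1"
    using assms by (intro powr_mono') auto
  then have "lam powr d * x powr d \<le> 1 / 4 * x powr d"
    using assms by (intro mult_right_mono) auto
  then have "(lam * x) powr d \<le> 1 / 4 * x powr d"
    using assms by (simp add: powr_mult)
  ultimately have "(1 / d) * (1 + t * (lam * x) powr d) powr (1 / d - 1) * (lam * x) powr d
      \<le> 1 * (1 / 4 * x powr d)"
    using assms by (intro mult_mono) auto
  then have "(1 / d) * (1 + t * (lam * x) powr d) powr (1 / d - 1) * (lam * x) powr d * weight lam d t x
      \<le> 1 * (1 / 4 * x powr d) * weight lam d t x"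
    by (intro mult_right_mono) (simp_all add: weight_def)
  then show ?thesis
    by (simp add: weight_dt_def)
qed

text \<open>The weight is frozen beyond \<open>R\<close>, and the factor \<open>x\<close> beyond a much larger \<open>S\<close>: fragmentation
  of sizes above \<open>S\<close> then violates monotonicity only by a term that the tail of a moment of \<open>f\<close>
  makes small, whatever the size of the weight at \<open>R\<close>.\<close>

definition cutoff :: "real \<Rightarrow> real \<Rightarrow> real \<Rightarrow> real \<Rightarrow> real \<Rightarrow> real \<Rightarrow> real" where
  "cutoff lam d R S t x = min x S * weight lam d t (min x R)"

lemma min_le_cutoff: "0 \<le> x \<Longrightarrow> 0 \<le> S \<Longrightarrow> min x S \<le> cutoff lam d R S t x"
  unfolding cutoff_def using mult_left_mono[OF weight_ge_1, of "min x S" lam d t "min x R"] by simp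

lemma cutoff_nonneg: "0 \<le> x \<Longrightarrow> 0 \<le> S \<Longrightarrow> 0 \<le> cutoff lam d R S t x"
  using min_le_cutoff[of x S lam d R t] by linarith

lemma cutoff_le:
  assumes "0 < lam" "1 \<le> d" "0 \<le> t" "t \<le> 1" "0 \<le> x" "0 \<le> R" "0 \<le> S"
  shows "cutoff lam d R S t x \<le> S * weight lam d 1 R"
  unfolding cutoff_def using assms
  by (intro mult_mono weight_mono) (auto simp: weight_def)

lemma cutoff_0_le: "0 \<le> x \<Longrightarrow> cutoff lam d R S 0 x \<le> exp 1 * x"
  by (simp add: cutoff_def weight_0)

text \<open>Up to \<open>S\<close> the size factor is additive and the weight is nondecreasing, so
  splitting a particle of size at most \<open>S\<close> cannot increase the functional.\<close>

lemma cutoff_superadditive: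
  assumes "0 < lam" "1 \<le> d" "0 \<le> t" "0 \<le> x" "0 \<le> y" "x + y \<le> S" "0 \<le> R"
  shows "cutoff lam d R S t x + cutoff lam d R S t y \<le> cutoff lam d R S t (x + y)"
proof -
  let ?W = "weight lam d t (min (x + y) R)"
  have "x * weight lam d t (min x R) \<le> x * ?W" "y * weight lam d t (min y R) \<le> y * ?W"
    using assms by (auto intro!: mult_left_mono weight_mono)
  then show ?thesis
    using assms by (simp add: cutoff_def min_absorb1 algebra_simps)
qed

text \<open>Above \<open>S\<close> the parent contributes the size factor \<open>S\<close>, which
  already covers \<open>min x S\<close>; only the piece \<open>y\<close> is left over. The constant
  \<open>weight lam d 1 R\<close> does not depend on \<open>S\<close>, so \<open>S\<close> can later
  be chosen large against it.\<close>

lemma cutoff_superadditive_error: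
  assumes "0 < lam" "1 \<le> d" "0 \<le> t" "t \<le> 1" "0 \<le> x" "0 \<le> y" "S \<le> x + y" "0 \<le> R" "0 \<le> S"
  shows "cutoff lam d R S t x + cutoff lam d R S t y - cutoff lam d R S t (x + y)
    \<le> weight lam d 1 R * cutoff lam d R S t y"
proof -
  let ?W = "weight lam d t (min (x + y) R)"
  have W: "?W \<le> weight lam d 1 R" "0 \<le> ?W"
    using assms by (auto intro!: weight_mono) (simp add: weight_def)
  have "min x S * weight lam d t (min x R) \<le> min x S * ?W" "min y S * weight lam d t (min y R) \<le> min y S * ?W"
    using assms by (auto intro!: mult_left_mono weight_mono)
  then have "cutoff lam d R S t x + cutoff lam d R S t y - cutoff lam d R S t (x + y)
      \<le> (min x S - S) * ?W + min y S * ?W"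
    using assms by (simp add: cutoff_def algebra_simps)
  also have "\<dots> \<le> min y S * ?W"
    using W by (simp add: mult_nonpos_nonneg)
  also have "\<dots> \<le> cutoff lam d R S t y * weight lam d 1 R"
    using W assms min_le_cutoff[of y S lam d R t] by (intro mult_mono) (auto intro: cutoff_nonneg)
  finally show ?thesis by (simp add: mult.commute)
qed

text \<open>The increment is split into \<open>x\<close> times the weight increment from
  \<open>x\<close> to \<open>x + y\<close> plus the same with the roles exchanged. Each part costs
  one factor \<open>lam\<close>, hence the 2.\<close>

lemma cutoff_increment_le:
  assumes "0 < lam" "1 \<le> d" "0 \<le> t" "t \<le> 1" "0 < x" "0 < y" "0 < R" "R \<le> S"
  shows "cutoff lam d R S t (x + y) - cutoff lam d R S t x - cutoff lam d R S t y
    \<le> 2 * lam * cutoff lam d R S t x * cutoff lam d R S t y"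
proof -
  let ?w = "\<lambda>x. weight lam d t (min x R)"
  have incr: "min u S * (?w (u + v) - ?w u) \<le> lam * cutoff lam d R S t u * cutoff lam d R S t v"
    if "0 < u" "0 < v" for u v
  proof -
    \<comment> \<open>Truncation at \<open>R\<close> is subadditive, so
      \<open>weight_increment_le\<close> can be applied to the truncated sizes.\<close>
    have "?w (u + v) \<le> weight lam d t (min u R + min v R)"
      using assms that by (intro weight_mono) auto
    then have "?w (u + v) - ?w u \<le> lam * min v R * ?w u * ?w v"
      using weight_increment_le[of lam d t "min u R" "min v R"] assms that by simp
    also have "\<dots> \<le> lam * min v S * ?w u * ?w v"
      using assms by (intro mult_right_mono mult_left_mono) (auto simp: weight_def)
    finally have "min u S * (?w (u + v) - ?w u) \<le> min u S * (lam * min v S * ?w u * ?w v)"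
      using assms that by (intro mult_left_mono) auto
    then show ?thesis
      by (simp add: cutoff_def ac_simps)
  qed
  have "min (x + y) S * ?w (x + y) \<le> (min x S + min y S) * ?w (x + y)"
    using assms by (intro mult_right_mono) (auto simp: weight_def)
  then show ?thesis
    using incr[of x y] incr[of y x] assms by (simp add: cutoff_def algebra_simps)
qed

text \<open>Constancy beyond \<open>S\<close> is what later reduces time differentiation of the
  infinite sum to a finite sum and the total number of particles.\<close>

lemma cutoff_eventually_const: "S \<le> x \<Longrightarrow> R \<le> S \<Longrightarrow> cutoff lam d R S t x = S * weight lam d t R"
  by (simp add: cutoff_def min_def)

lemma cutoff_eq: "x \<le> R \<Longrightarrow> R \<le> S \<Longrightarrow> cutoff lam d R S t x = x * weight lam d t x"
  by (simp add: cutoff_def min_def)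

lemma cutoff_has_time_derivative:
  assumes "0 < lam" "1 \<le> d" "0 \<le> t" "0 \<le> x" "0 \<le> R"
  shows "((\<lambda>s. cutoff lam d R S s x) has_real_derivative min x S * weight_dt lam d t (min x R)) (at t within A)"
  unfolding cutoff_def using assms by (intro DERIV_cmult weight_has_time_derivative) auto

lemma cutoff_dt_le:
  assumes "0 < lam" "lam \<le> 1 / 4" "1 \<le> d" "0 \<le> t" "0 \<le> x" "0 \<le> R" "0 \<le> S"
  shows "min x S * weight_dt lam d t (min x R) \<le> 1 / 4 * (x powr d * cutoff lam d R S t x)"
proof -
  have "weight_dt lam d t (min x R) \<le> 1 / 4 * min x R powr d * weight lam d t (min x R)"
    using assms by (intro weight_dt_le) auto
  also have "\<dots> \<le> 1 / 4 * x powr d * weight lam d t (min x R)"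
    using assms by (intro mult_right_mono mult_left_mono powr_mono2) (auto simp: weight_def)
  finally have "min x S * weight_dt lam d t (min x R) \<le> min x S * (1 / 4 * x powr d * weight lam d t (min x R))"
    using assms by (intro mult_left_mono) auto
  then show ?thesis
    by (simp add: cutoff_def ac_simps)
qed

section \<open>Kernel bounds, interpolation of powers and a continuation argument\<close>

lemma kern_nonneg: "0 \<le> kern a b x y"
  by (simp add: kern_def)

text \<open>Both sizes are replaced by their maximum, whose power is one of the two
  summands.\<close>

lemma kern_le_sum:
  assumes "0 < a" "0 < b" "0 < x" "0 < y"
  shows "kern a b x y \<le> 2 powr b * (x powr (2 * a + b) + y powr (2 * a + b))"
proof -
  define z where "z = max x y"
  have "kern a b x y \<le> z powr a * z powr a * (2 * z) powr b"
    unfolding kern_def using assms by (intro mult_mono powr_mono2) (auto simp: z_def)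
  also have "\<dots> = 2 powr b * z powr (2 * a + b)"
    using assms by (simp add: z_def powr_mult flip: powr_add)
  also have "\<dots> \<le> 2 powr b * (x powr (2 * a + b) + y powr (2 * a + b))"
    by (intro mult_left_mono) (auto simp: z_def max_def)
  finally show ?thesis .
qed

lemma kern_diff_le:
  assumes "0 < a" "0 < b" "0 < y" "y < x"
  shows "kern a b (x - y) y \<le> x powr (a + b) * y powr a"
proof -
  have "kern a b (x - y) y \<le> x powr a * y powr a * x powr b"
    unfolding kern_def using assms by (intro mult_mono powr_mono2) auto
  then show ?thesis
    by (simp add: powr_add ac_simps)
qed

lemma powr_le_one_plus_powr:
  assumes "0 < x" "0 \<le> a" "a \<le> b"
  shows "x powr a \<le> 1 + x powr (b::real)"
proof (cases "x \<le> 1")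
  case True
  then have "x powr a \<le> 1"
    using assms by (simp add: powr_le1)
  then show ?thesis
    by (simp add: add_increasing2)
next
  case False
  then show ?thesis
    using powr_mono[OF assms(3), of x] by linarith
qed

text \<open>The value of \<open>A * x powr p\<close> at the size where
  \<open>2 * A * x powr p = x powr d\<close>. Below that size the value itself is the bound; above
  it half of \<open>x powr d\<close> suffices.\<close>

definition young :: "real \<Rightarrow> real \<Rightarrow> real \<Rightarrow> real" where
  "young A p d = A * ((2 * A) powr (1 / (d - p))) powr p"

lemma powr_le_young:
  assumes "0 < A" "0 < p" "p < d" "0 < x"
  shows "A * x powr p \<le> 1 / 2 * x powr d + young A p d"
proof (cases "x \<le> (2 * A) powr (1 / (d - p))")
  case True
  then have "A * x powr p \<le> young A p d"
    unfolding young_def using assms by (intro mult_left_mono powr_mono2) auto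
  then show ?thesis
    by (simp add: add_increasing)
next
  case False
  have "2 * A = ((2 * A) powr (1 / (d - p))) powr (d - p)"
    using assms by (simp add: powr_powr)
  also have "\<dots> \<le> x powr (d - p)"
    using False assms by (intro powr_mono2) auto
  finally have "2 * A * x powr p \<le> x powr (d - p) * x powr p"
    by (intro mult_right_mono) auto
  also have "\<dots> = x powr d"
    by (simp flip: powr_add)
  finally show ?thesis
    using assms by (simp add: young_def add_increasing2)
qed

text \<open>The differential inequality is assumed only while \<open>u\<close> is at most
  \<open>B\<close>. Up to the first time at which \<open>u\<close> reaches \<open>B\<close>,
  Gronwall's bound keeps it strictly below \<open>B\<close>, a contradiction.\<close>

lemma bootstrap_gronwall:
  fixes u u' :: "real \<Rightarrow> real"
  assumes deriv: "\<And>t. 0 \<le> t \<Longrightarrow> t \<le> T \<Longrightarrow> (u has_real_derivative u' t) (at t within {0..T})"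
    and le: "\<And>t. 0 \<le> t \<Longrightarrow> t \<le> T \<Longrightarrow> u t \<le> B \<Longrightarrow> u' t \<le> a * u t"
    and init: "u 0 * exp (a * T) < B" and nonneg: "0 \<le> a" "0 \<le> u 0" and t: "0 \<le> t" "t \<le> T"
  shows "u t < B"
proof (rule ccontr)
  assume "\<not> u t < B"
  define Z where "Z = {s \<in> {0..T}. B \<le> u s}"
  have cont: "continuous_on {0..T} u"
    using deriv by (intro DERIV_continuous_on) auto
  then have "closed Z"
    unfolding Z_def by (intro continuous_on_closed_Collect_le) auto
  \<comment> \<open>By continuity \<open>Z\<close> is closed, so its infimum is attained and is the
    first time at level \<open>B\<close>.\<close>
  define s where "s = Inf Z"
  have Z: "t \<in> Z" "bdd_below Z"
    using \<open>\<not> u t < B\<close> t by (auto simp: Z_def)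
  then have sZ: "s \<in> Z"
    unfolding s_def using \<open>closed Z\<close> by (intro closed_contains_Inf) auto
  have before: "u r < B" if "0 \<le> r" "r < s" for r
    using cInf_lower[OF _ Z(2), of r] that sZ by (force simp: Z_def s_def)
  have s: "0 \<le> s" "s \<le> T" "B \<le> u s"
    using sZ by (auto simp: Z_def)
  have "u s * exp (- a * s) \<le> u 0 * exp (- a * 0)"
  proof (rule DERIV_nonpos_imp_decreasing_open[where f = "\<lambda>r. u r * exp (- a * r)"])
    fix r assume r: "0 < r" "r < s"
    then have "at r within {0..T} = at r"
      using s by (intro at_within_Icc_at) auto
    then have "(u has_real_derivative u' r) (at r)"
      using deriv[of r] r s by simp
    then have "((\<lambda>r. u r * exp (- a * r)) has_real_derivative (u' r - a * u r) * exp (- a * r)) (at r)"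
      by (auto intro!: derivative_eq_intros simp: algebra_simps)
    moreover have "(u' r - a * u r) * exp (- a * r) \<le> 0"
      using le[of r] before[of r] r s by (intro mult_nonpos_nonneg) auto
    ultimately show "\<exists>y. ((\<lambda>r. u r * exp (- a * r)) has_real_derivative y) (at r) \<and> y \<le> 0"
      by blast
  next
    show "continuous_on {0..s} (\<lambda>r. u r * exp (- a * r))"
      using s by (intro continuous_intros continuous_on_subset[OF cont]) auto
  qed (use s in auto)
  then have "u s \<le> u 0 * exp (a * s)"
    by (simp add: exp_minus field_simps)
  also have "\<dots> \<le> u 0 * exp (a * T)"
    using nonneg s by (intro mult_left_mono) (auto intro: mult_left_mono)
  finally show False
    using init s by simp
qed

section \<open>Estimates at a fixed time\<close>

text \<open>The state at one fixed time, detached from the evolution: nonnegative, summable, with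
  one finite moment of high order.\<close>

locale moment_slice =
  fixes h \<kappa> :: real and f :: "nat \<Rightarrow> real"
  assumes h_pos: "0 < h"
    and f_nonneg: "\<And>i. i \<ge> 1 \<Longrightarrow> 0 \<le> f i"
    and f_summable: "f summable_on {1..}"
    and moment_summable: "(\<lambda>i. f i * (real i * h) powr \<kappa>) summable_on {1..}"
begin

section \<open>Summability of moments and of pair sums\<close>

lemma lower_moment_summable:
  assumes "0 \<le> k" "k \<le> \<kappa>"
  shows "(\<lambda>i. f i * (real i * h) powr k) summable_on {1..}"
proof (rule summable_on_comparison_test)
  show "(\<lambda>i. f i + f i * (real i * h) powr \<kappa>) summable_on {1..}"
    by (intro summable_on_add f_summable moment_summable)
  fix i :: nat assume "i \<in> {1..}"
  then have i: "i \<ge> 1" by simp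
  have "f i * (real i * h) powr k \<le> f i * (1 + (real i * h) powr \<kappa>)"
    using i assms h_pos f_nonneg by (intro mult_left_mono powr_le_one_plus_powr) auto
  then show "f i * (real i * h) powr k \<le> f i + f i * (real i * h) powr \<kappa>"
    by (simp add: algebra_simps)
  show "0 \<le> f i * (real i * h) powr k"
    using i f_nonneg by simp
qed

lemma weighted_moment_summable:
  assumes "0 \<le> k" "k \<le> \<kappa>" "\<And>i. i \<ge> 1 \<Longrightarrow> \<bar>\<phi> i\<bar> \<le> B"
  shows "(\<lambda>i. f i * (real i * h) powr k * \<phi> i) summable_on {1..}"
  by (rule summable_on_mult_bounded[OF lower_moment_summable[OF assms(1,2)]]) (use assms(3) in auto)

lemma coag_pairs_summable:
  assumes "0 < a" "0 < b" "2 * a + b \<le> \<kappa>"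
  shows "(\<lambda>(j, k). kern a b (real j * h) (real k * h) * f j * f k) summable_on {1..} \<times> {1..}"
proof (rule summable_on_comparison_test)
  let ?p = "2 * a + b"
  note F = has_sum_infsum[OF f_summable]
  note M = has_sum_infsum[OF lower_moment_summable[of ?p]]
  have "(\<lambda>x. 2 powr b * ((case x of (j, k) \<Rightarrow> (f j * (real j * h) powr ?p) * f k)
      + (case x of (j, k) \<Rightarrow> f j * (f k * (real k * h) powr ?p)))) summable_on {1..} \<times> {1..}"
    by (intro summable_on_cmult_right summable_on_add has_sum_imp_summable
        [OF has_sum_product_nonneg[OF M F]] has_sum_imp_summable[OF has_sum_product_nonneg[OF F M]])
      (use assms f_nonneg in auto)
  then show "(\<lambda>(j, k). 2 powr b * (f j * (real j * h) powr ?p * f k + f j * (f k * (real k * h) powr ?p)))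
      summable_on {1..} \<times> {1..}"
    by (simp add: split_def)
next
  fix x :: "nat \<times> nat" assume "x \<in> {1..} \<times> {1..}"
  then obtain j k where x: "x = (j, k)" "j \<ge> 1" "k \<ge> 1" by auto
  have "kern a b (real j * h) (real k * h) * (f j * f k)
      \<le> 2 powr b * ((real j * h) powr (2 * a + b) + (real k * h) powr (2 * a + b)) * (f j * f k)"
    using x assms h_pos f_nonneg by (intro mult_right_mono kern_le_sum) auto
  then show "(case x of (j, k) \<Rightarrow> kern a b (real j * h) (real k * h) * f j * f k)
      \<le> (case x of (j, k) \<Rightarrow> 2 powr b * (f j * (real j * h) powr (2 * a + b) * f k
          + f j * (f k * (real k * h) powr (2 * a + b))))"
    by (simp add: x algebra_simps)
  show "0 \<le> (case x of (j, k) \<Rightarrow> kern a b (real j * h) (real k * h) * f j * f k)"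
    using x f_nonneg by (simp add: kern_nonneg)
qed

lemma frag_pairs_summable:
  assumes "0 < a" "0 < b" "a + b \<le> \<kappa>"
  shows "(\<lambda>(j, k). kern a b (real (j - k) * h) (real k * h) * f j * f k) summable_on subpairs"
proof (rule summable_on_comparison_test)
  have "(\<lambda>(j, k). (f j * (real j * h) powr (a + b)) * (f k * (real k * h) powr a)) summable_on {1..} \<times> {1..}"
    by (rule has_sum_imp_summable[OF has_sum_product_nonneg[OF
          has_sum_infsum[OF lower_moment_summable] has_sum_infsum[OF lower_moment_summable]]])
      (use assms f_nonneg in auto)
  then show "(\<lambda>(j, k). (f j * (real j * h) powr (a + b)) * (f k * (real k * h) powr a)) summable_on subpairs"
    by (rule summable_on_subset_banach) auto
next
  fix x assume "x \<in> subpairs"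
  then obtain j k where x: "x = (j, k)" "1 \<le> k" "k < j" by auto
  have "kern a b (real j * h - real k * h) (real k * h) * (f j * f k)
      \<le> (real j * h) powr (a + b) * (real k * h) powr a * (f j * f k)"
    using x assms h_pos f_nonneg by (intro mult_right_mono kern_diff_le) auto
  then show "(case x of (j, k) \<Rightarrow> kern a b (real (j - k) * h) (real k * h) * f j * f k)
      \<le> (case x of (j, k) \<Rightarrow> (f j * (real j * h) powr (a + b)) * (f k * (real k * h) powr a))"
    using x by (simp add: algebra_simps)
  show "0 \<le> (case x of (j, k) \<Rightarrow> kern a b (real (j - k) * h) (real k * h) * f j * f k)"
    using x f_nonneg by (simp add: kern_nonneg)
qed

text \<open>A Markov-type estimate: for sizes above \<open>S\<close> and
  \<open>k \<le> \<kappa>\<close>, the power of order \<open>k\<close> is at most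
  \<open>S powr (k - \<kappa>)\<close> times that of order \<open>\<kappa>\<close>.\<close>

lemma tail_moment_le:
  assumes "0 \<le> k" "k \<le> \<kappa>" "0 < S"
  obtains U where "((\<lambda>i. if S < real i * h then f i * (real i * h) powr k else 0) has_sum U) {1..}"
    "U \<le> S powr (k - \<kappa>) * moment h \<kappa> f" "0 \<le> U"
proof -
  let ?u = "\<lambda>i. if S < real i * h then f i * (real i * h) powr k else 0"
  have "?u summable_on {1..}"
    by (rule summable_on_comparison_test[OF lower_moment_summable[OF assms(1,2)]])
      (auto simp: f_nonneg)
  then obtain U where U: "(?u has_sum U) {1..}"
    by (auto simp: summable_on_def)
  have M: "((\<lambda>i. S powr (k - \<kappa>) * (f i * (real i * h) powr \<kappa>)) has_sum S powr (k - \<kappa>) * moment h \<kappa> f) {1..}"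
    unfolding moment_def by (intro has_sum_cmult_right has_sum_infsum moment_summable)
  have "U \<le> S powr (k - \<kappa>) * moment h \<kappa> f"
  proof (rule has_sum_mono[OF U M])
    fix i :: nat assume i: "i \<in> {1..}"
    show "?u i \<le> S powr (k - \<kappa>) * (f i * (real i * h) powr \<kappa>)"
    proof (cases "S < real i * h")
      case True
      have "(real i * h) powr k = (real i * h) powr (k - \<kappa>) * (real i * h) powr \<kappa>"
        by (simp flip: powr_add)
      also have "\<dots> \<le> S powr (k - \<kappa>) * (real i * h) powr \<kappa>"
        using True assms by (intro mult_right_mono powr_mono2') auto
      finally show ?thesis
        using True i f_nonneg[of i] by (auto simp: algebra_simps dest: mult_left_mono)
    qed (use i f_nonneg[of i] in simp)
  qed
  moreover have "0 \<le> U"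
    using U by (rule has_sum_nonneg) (auto simp: f_nonneg)
  ultimately show thesis
    using that U by blast
qed

text \<open>The increment bound and \<open>kern_le_sum\<close> turn every pair term into a sum of
  two products in \<open>j\<close> and \<open>k\<close>. Summed, each product gives the same value,
  so the constant \<open>2 powr (\<beta> 1 + 1)\<close> doubles.\<close>

lemma coag_cutoff_le:
  fixes \<alpha> \<beta> :: "nat \<Rightarrow> real"
  defines "p \<equiv> 2 * \<alpha> 1 + \<beta> 1"
  assumes ab: "0 < \<alpha> 1" "0 < \<beta> 1" "p \<le> \<kappa>"
    and par: "0 < lam" "1 \<le> d" "0 \<le> t" "t \<le> 1" "0 < R" "R \<le> S"
  defines "\<phi> \<equiv> \<lambda>i. cutoff lam d R S t (real i * h)"
  obtains s where "((\<lambda>i. coag h \<alpha> \<beta> f i * \<phi> i) has_sum s) {1..}"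
    "s \<le> 2 powr (\<beta> 1 + 2) * lam * (\<Sum>\<^sub>\<infinity>i\<in>{1..}. f i * \<phi> i)
          * (\<Sum>\<^sub>\<infinity>i\<in>{1..}. f i * (real i * h) powr p * \<phi> i)"
proof
  let ?K = "\<lambda>j k. kern (\<alpha> 1) (\<beta> 1) (real j * h) (real k * h) * f j * f k"
  have \<phi>_nonneg: "0 \<le> \<phi> i" for i
    using h_pos par by (auto simp: \<phi>_def intro!: cutoff_nonneg)
  have \<phi>_bound: "\<bar>\<phi> i\<bar> \<le> S * weight lam d 1 R" for i
    using \<phi>_nonneg[of i] h_pos par by (auto simp: \<phi>_def intro!: cutoff_le)
  have K: "(\<lambda>(j, k). ?K j k) summable_on {1..} \<times> {1..}"
    using ab by (intro coag_pairs_summable) (auto simp: p_def)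
  note weak = coag_weak_form[where \<alpha> = \<alpha> and \<beta> = \<beta> and h = h and f = f and \<phi> = \<phi>, OF K \<phi>_bound]
  show "((\<lambda>i. coag h \<alpha> \<beta> f i * \<phi> i) has_sum
      (\<Sum>\<^sub>\<infinity>(j, k)\<in>{1..} \<times> {1..}. ?K j k * (\<phi> (j + k) - \<phi> j - \<phi> k))) {1..}"
    by (rule weak(1))
  define \<Phi> P where "\<Phi> = (\<Sum>\<^sub>\<infinity>i\<in>{1..}. f i * \<phi> i)"
    and "P = (\<Sum>\<^sub>\<infinity>i\<in>{1..}. f i * (real i * h) powr p * \<phi> i)"
  have \<Phi>: "((\<lambda>i. f i * \<phi> i) has_sum \<Phi>) {1..}"
    unfolding \<Phi>_def by (intro has_sum_infsum summable_on_mult_bounded[OF f_summable \<phi>_bound])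
  have P: "((\<lambda>i. f i * (real i * h) powr p * \<phi> i) has_sum P) {1..}"
    unfolding P_def using ab
    by (intro has_sum_infsum weighted_moment_summable[OF _ _ \<phi>_bound]) (auto simp: p_def)
  have "((\<lambda>x. 2 powr (\<beta> 1 + 1) * lam * ((case x of (j, k) \<Rightarrow> (f j * (real j * h) powr p * \<phi> j) * (f k * \<phi> k))
      + (case x of (j, k) \<Rightarrow> (f j * \<phi> j) * (f k * (real k * h) powr p * \<phi> k))))
      has_sum 2 powr (\<beta> 1 + 1) * lam * (P * \<Phi> + \<Phi> * P)) ({1..} \<times> {1..})"
    by (intro has_sum_cmult_right has_sum_add has_sum_product_nonneg P \<Phi>)
      (auto simp: f_nonneg \<phi>_nonneg)
  then have bound: "((\<lambda>(j, k). 2 powr (\<beta> 1 + 1) * lam * ((f j * (real j * h) powr p * \<phi> j) * (f k * \<phi> k)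
      + (f j * \<phi> j) * (f k * (real k * h) powr p * \<phi> k)))
      has_sum 2 powr (\<beta> 1 + 1) * lam * (P * \<Phi> + \<Phi> * P)) ({1..} \<times> {1..})"
    by (simp add: split_def)
  have "(\<Sum>\<^sub>\<infinity>(j, k)\<in>{1..} \<times> {1..}. ?K j k * (\<phi> (j + k) - \<phi> j - \<phi> k))
      \<le> 2 powr (\<beta> 1 + 1) * lam * (P * \<Phi> + \<Phi> * P)"
  proof (rule has_sum_mono[OF has_sum_infsum[OF weak(2)] bound])
    fix x :: "nat \<times> nat" assume "x \<in> {1..} \<times> {1..}"
    then obtain j k where x: "x = (j, k)" "j \<ge> 1" "k \<ge> 1" by auto
    have "\<phi> (j + k) - \<phi> j - \<phi> k \<le> 2 * lam * \<phi> j * \<phi> k"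
      using cutoff_increment_le[OF par(1-4) _ _ par(5,6), of "real j * h" "real k * h"] x h_pos
      by (simp add: \<phi>_def algebra_simps)
    then have "?K j k * (\<phi> (j + k) - \<phi> j - \<phi> k) \<le> ?K j k * (2 * lam * \<phi> j * \<phi> k)"
      using x by (intro mult_left_mono) (auto simp: f_nonneg kern_nonneg)
    also have "\<dots> = kern (\<alpha> 1) (\<beta> 1) (real j * h) (real k * h) * (f j * f k * (2 * lam * \<phi> j * \<phi> k))"
      by (simp add: ac_simps)
    also have "\<dots> \<le> 2 powr \<beta> 1 * ((real j * h) powr p + (real k * h) powr p)
        * (f j * f k * (2 * lam * \<phi> j * \<phi> k))"
      unfolding p_def using x h_pos ab par
      by (intro mult_right_mono kern_le_sum) (auto simp: f_nonneg \<phi>_nonneg)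
    finally show "(case x of (j, k) \<Rightarrow> ?K j k * (\<phi> (j + k) - \<phi> j - \<phi> k))
      \<le> (case x of (j, k) \<Rightarrow> 2 powr (\<beta> 1 + 1) * lam * ((f j * (real j * h) powr p * \<phi> j) * (f k * \<phi> k)
      + (f j * \<phi> j) * (f k * (real k * h) powr p * \<phi> k)))"
      by (simp add: x powr_add algebra_simps)
  qed
  then show "(\<Sum>\<^sub>\<infinity>(j, k)\<in>{1..} \<times> {1..}. ?K j k * (\<phi> (j + k) - \<phi> j - \<phi> k))
      \<le> 2 powr (\<beta> 1 + 2) * lam * \<Phi> * P"
    by (simp add: powr_add algebra_simps)
qed

text \<open>Parents of size at most \<open>S\<close> contribute nonpositively. For larger ones the
  pair sum is bounded by a product whose first factor is a moment tail beyond \<open>S\<close>,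
  small for large \<open>S\<close>.\<close>

lemma frag_cutoff_le:
  fixes \<alpha> \<beta> :: "nat \<Rightarrow> real"
  assumes ab: "0 < \<alpha> n" "0 < \<beta> n" "\<alpha> n + \<beta> n \<le> d" "d \<le> \<kappa>"
    and par: "0 < lam" "1 \<le> d" "0 \<le> t" "t \<le> 1" "0 < R" "R \<le> S"
  defines "\<phi> \<equiv> \<lambda>i. cutoff lam d R S t (real i * h)"
  obtains s where "((\<lambda>i. frag n h \<alpha> \<beta> f i * \<phi> i) has_sum s) {1..}"
    "s \<le> weight lam d 1 R * (S powr (\<alpha> n + \<beta> n - \<kappa>) * moment h \<kappa> f)
      * ((\<Sum>\<^sub>\<infinity>i\<in>{1..}. f i * \<phi> i) + (\<Sum>\<^sub>\<infinity>i\<in>{1..}. f i * (real i * h) powr d * \<phi> i))"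
proof
  let ?K = "\<lambda>n j k. kern (\<alpha> n) (\<beta> n) (real (j - k) * h) (real k * h) * f j * f k"
  let ?W = "weight lam d 1 R"
  have W: "0 \<le> ?W"
    by (simp add: weight_def)
  have \<phi>_nonneg: "0 \<le> \<phi> i" for i
    using h_pos par by (auto simp: \<phi>_def intro!: cutoff_nonneg)
  have \<phi>_bound: "\<bar>\<phi> i\<bar> \<le> S * weight lam d 1 R" for i
    using \<phi>_nonneg[of i] h_pos par by (auto simp: \<phi>_def intro!: cutoff_le)
  have K: "(\<lambda>(j, k). ?K n j k) summable_on subpairs"
    using ab by (intro frag_pairs_summable) auto
  note weak = frag_weak_form[where n = n and \<alpha> = \<alpha> and \<beta> = \<beta> and h = h and f = f and \<phi> = \<phi>, OF K \<phi>_bound]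
  show "((\<lambda>i. frag n h \<alpha> \<beta> f i * \<phi> i) has_sum
           (\<Sum>\<^sub>\<infinity>(j, k)\<in>subpairs. ?K n j k * (\<phi> (j - k) + \<phi> k - \<phi> j))) {1..}"
    by (rule weak(1))
  define \<Phi> D where "\<Phi> = (\<Sum>\<^sub>\<infinity>i\<in>{1..}. f i * \<phi> i)"
    and "D = (\<Sum>\<^sub>\<infinity>i\<in>{1..}. f i * (real i * h) powr d * \<phi> i)"
  have \<Phi>: "((\<lambda>i. f i * \<phi> i) has_sum \<Phi>) {1..}"
    unfolding \<Phi>_def by (intro has_sum_infsum summable_on_mult_bounded[OF f_summable \<phi>_bound])
  have D: "((\<lambda>i. f i * (real i * h) powr d * \<phi> i) has_sum D) {1..}"
    unfolding D_def using ab par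
    by (intro has_sum_infsum weighted_moment_summable[OF _ _ \<phi>_bound]) auto
  have V: "((\<lambda>i. ?W * (f i * \<phi> i + f i * (real i * h) powr d * \<phi> i)) has_sum ?W * (\<Phi> + D)) {1..}"
    by (intro has_sum_cmult_right has_sum_add \<Phi> D)
  have nn: "0 \<le> ?W * (\<Phi> + D)"
    using V by (rule has_sum_nonneg) (auto simp: W f_nonneg \<phi>_nonneg)
  obtain U where U: "((\<lambda>i. if S < real i * h then f i * (real i * h) powr (\<alpha> n + \<beta> n) else 0) has_sum U) {1..}"
    "U \<le> S powr (\<alpha> n + \<beta> n - \<kappa>) * moment h \<kappa> f" "0 \<le> U"
    using tail_moment_le[of "\<alpha> n + \<beta> n" S] ab par by auto
  note UV = has_sum_product_nonneg[OF U(1) V]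
  have "(\<Sum>\<^sub>\<infinity>(j, k)\<in>subpairs. ?K n j k * (\<phi> (j - k) + \<phi> k - \<phi> j)) \<le> U * (?W * (\<Phi> + D))"
  \<comment> \<open>The majorant is nonnegative, so it may be summed over all pairs, where it
    factorizes.\<close>
  proof (rule has_sum_mono_neutral[OF has_sum_infsum[OF weak(2)] UV])
    fix x assume "x \<in> subpairs \<inter> {1..} \<times> {1..}"
    then obtain j k where x: "x = (j, k)" "1 \<le> k" "k < j" by auto
    define z y where "z = real j * h" and "y = real k * h"
    have zy: "0 < y" "y < z" "real (j - k) * h = z - y"
      using x h_pos by (auto simp: z_def y_def algebra_simps)
    have \<phi>: "\<phi> (j - k) = cutoff lam d R S t (z - y)" "\<phi> k = cutoff lam d R S t y" "\<phi> j = cutoff lam d R S t z"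
      by (simp_all only: \<phi>_def zy(3) flip: z_def y_def)
    have kn: "0 \<le> ?K n j k"
      using x by (simp add: kern_nonneg f_nonneg)
    show "(case x of (j, k) \<Rightarrow> ?K n j k * (\<phi> (j - k) + \<phi> k - \<phi> j))
      \<le> (case x of (j, k) \<Rightarrow> (if S < real j * h then f j * (real j * h) powr (\<alpha> n + \<beta> n) else 0)
            * (?W * (f k * \<phi> k + f k * (real k * h) powr d * \<phi> k)))"
    proof (cases "S < z")
      case False
      have "\<phi> (j - k) + \<phi> k - \<phi> j \<le> 0"
        using cutoff_superadditive[OF par(1-3), of "z - y" y S R] zy False par
        by (simp add: \<phi>)
      then have "?K n j k * (\<phi> (j - k) + \<phi> k - \<phi> j) \<le> 0"
        using kn by (rule mult_nonneg_nonpos[rotated])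
      then show ?thesis
        using False by (simp add: x z_def)
    next
      case True
      have "\<phi> (j - k) + \<phi> k - \<phi> j \<le> ?W * \<phi> k"
        using cutoff_superadditive_error[OF par(1-4), of "z - y" y S R] zy True par
        by (simp add: \<phi>)
      then have "?K n j k * (\<phi> (j - k) + \<phi> k - \<phi> j) \<le> ?K n j k * (?W * \<phi> k)"
        using kn by (rule mult_left_mono)
      also have "\<dots> = kern (\<alpha> n) (\<beta> n) (z - y) y * (f j * f k * (?W * \<phi> k))"
        unfolding zy(3) by (simp add: y_def ac_simps)
      also have "\<dots> \<le> z powr (\<alpha> n + \<beta> n) * y powr \<alpha> n * (f j * f k * (?W * \<phi> k))"
        using x zy ab W by (intro mult_right_mono kern_diff_le) (auto simp: f_nonneg \<phi>_nonneg)
      also have "\<dots> = y powr \<alpha> n * (z powr (\<alpha> n + \<beta> n) * (f j * f k * (?W * \<phi> k)))"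
        by (simp add: ac_simps)
      \<comment> \<open>Replacing the power of order \<open>\<alpha> n\<close> leaves only the two
        sums \<open>\<Phi>\<close> and \<open>D\<close>, the second of which the damping can
        absorb.\<close>
      also have "\<dots> \<le> (1 + y powr d) * (z powr (\<alpha> n + \<beta> n) * (f j * f k * (?W * \<phi> k)))"
        using x zy ab W by (intro mult_right_mono powr_le_one_plus_powr) (auto simp: f_nonneg \<phi>_nonneg)
      finally show ?thesis
        using True by (simp add: x z_def y_def algebra_simps)
    qed
  next
    fix x :: "nat \<times> nat" assume "x \<in> {1..} \<times> {1..} - subpairs"
    then show "0 \<le> (case x of (j, k) \<Rightarrow> (if S < real j * h then f j * (real j * h) powr (\<alpha> n + \<beta> n) else 0)
            * (?W * (f k * \<phi> k + f k * (real k * h) powr d * \<phi> k)))"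
      using W by (auto simp: f_nonneg \<phi>_nonneg)
  qed (use W in \<open>auto simp: f_nonneg \<phi>_nonneg\<close>)
  also have "\<dots> \<le> (S powr (\<alpha> n + \<beta> n - \<kappa>) * moment h \<kappa> f) * (?W * (\<Phi> + D))"
    using U nn by (intro mult_right_mono) auto
  finally show "(\<Sum>\<^sub>\<infinity>(j, k)\<in>subpairs. ?K n j k * (\<phi> (j - k) + \<phi> k - \<phi> j))
      \<le> ?W * (S powr (\<alpha> n + \<beta> n - \<kappa>) * moment h \<kappa> f) * (\<Phi> + D)"
    by (simp add: ac_simps)
qed

text \<open>The damping supplies \<open>- D\<close>. Coagulation uses one half of it and the two
  fragmentation terms one eighth each; the remaining quarter is kept for the growth of the weight in
  time.\<close>

lemma rhs_cutoff_le:
  fixes \<alpha> \<beta> :: "nat \<Rightarrow> real"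
  assumes ab: "\<And>n. n \<in> {1, 2, 3} \<Longrightarrow> 0 < \<alpha> n \<and> 0 < \<beta> n \<and> \<alpha> n + \<beta> n \<le> d"
    and p: "2 * \<alpha> 1 + \<beta> 1 < d" and d: "1 \<le> d" "d \<le> \<kappa>"
    and par: "0 < lam" "0 \<le> t" "t \<le> 1" "0 < R" "R \<le> S"
    and S: "\<And>n. n \<in> {2, 3} \<Longrightarrow> weight lam d 1 R * (S powr (\<alpha> n + \<beta> n - \<kappa>) * moment h \<kappa> f) \<le> 1 / 8"
  defines "\<phi> \<equiv> \<lambda>i. cutoff lam d R S t (real i * h)"
  assumes small: "(\<Sum>\<^sub>\<infinity>i\<in>{1..}. f i * \<phi> i) \<le> 1 / (2 * lam)"
  shows "(\<Sum>\<^sub>\<infinity>i\<in>{1..}. rhs h \<alpha> \<beta> d f i * \<phi> i)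
    \<le> (young (2 powr (\<beta> 1 + 1)) (2 * \<alpha> 1 + \<beta> 1) d + 1 / 4) * (\<Sum>\<^sub>\<infinity>i\<in>{1..}. f i * \<phi> i)
        - 1 / 4 * (\<Sum>\<^sub>\<infinity>i\<in>{1..}. f i * (real i * h) powr d * \<phi> i)"
proof -
  define p where "p = 2 * \<alpha> 1 + \<beta> 1"
  define A where "A = 2 powr (\<beta> 1 + 1)"
  have \<phi>_nonneg: "0 \<le> \<phi> i" for i
    using h_pos par by (auto simp: \<phi>_def intro!: cutoff_nonneg)
  have \<phi>_bound: "\<bar>\<phi> i\<bar> \<le> S * weight lam d 1 R" for i
    using \<phi>_nonneg[of i] h_pos d par by (auto simp: \<phi>_def intro!: cutoff_le)
  have pd: "0 < p" "p < d" and A: "0 < A"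
    using ab[of 1] p by (auto simp: p_def A_def)
  define \<Phi> P D where "\<Phi> = (\<Sum>\<^sub>\<infinity>i\<in>{1..}. f i * \<phi> i)"
    and "P = (\<Sum>\<^sub>\<infinity>i\<in>{1..}. f i * (real i * h) powr p * \<phi> i)"
    and "D = (\<Sum>\<^sub>\<infinity>i\<in>{1..}. f i * (real i * h) powr d * \<phi> i)"
  have \<Phi>: "((\<lambda>i. f i * \<phi> i) has_sum \<Phi>) {1..}"
    unfolding \<Phi>_def by (intro has_sum_infsum summable_on_mult_bounded[OF f_summable \<phi>_bound])
  have P: "((\<lambda>i. f i * (real i * h) powr p * \<phi> i) has_sum P) {1..}"
    unfolding P_def using pd d
    by (intro has_sum_infsum weighted_moment_summable[OF _ _ \<phi>_bound]) auto
  have D: "((\<lambda>i. f i * (real i * h) powr d * \<phi> i) has_sum D) {1..}"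
    unfolding D_def using d by (intro has_sum_infsum weighted_moment_summable[OF _ _ \<phi>_bound]) auto
  have nonneg: "0 \<le> \<Phi>" "0 \<le> P" "0 \<le> D"
    by (auto intro: has_sum_nonneg[OF \<Phi>] has_sum_nonneg[OF P] has_sum_nonneg[OF D] simp: f_nonneg \<phi>_nonneg)
  have "p \<le> \<kappa>"
    using pd d by simp
  then obtain s1 where s1: "((\<lambda>i. coag h \<alpha> \<beta> f i * \<phi> i) has_sum s1) {1..}"
    "s1 \<le> 2 powr (\<beta> 1 + 2) * lam * \<Phi> * P"
    using coag_cutoff_le[of \<alpha> \<beta> lam d t R S] ab[of 1] par d
    unfolding \<phi>_def \<Phi>_def P_def p_def by auto
  have frag: "\<exists>s. ((\<lambda>i. frag n h \<alpha> \<beta> f i * \<phi> i) has_sum s) {1..} \<and> s \<le> 1 / 8 * (\<Phi> + D)"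
    if n: "n \<in> {2, 3}" for n
  proof -
    obtain s where s: "((\<lambda>i. frag n h \<alpha> \<beta> f i * \<phi> i) has_sum s) {1..}"
      "s \<le> weight lam d 1 R * (S powr (\<alpha> n + \<beta> n - \<kappa>) * moment h \<kappa> f) * (\<Phi> + D)"
      using frag_cutoff_le[of \<alpha> n \<beta> d lam t R S] ab[of n] n par d
      unfolding \<phi>_def \<Phi>_def D_def by auto
    note s(2)
    also have "weight lam d 1 R * (S powr (\<alpha> n + \<beta> n - \<kappa>) * moment h \<kappa> f) * (\<Phi> + D) \<le> 1 / 8 * (\<Phi> + D)"
      using S[OF n] nonneg by (intro mult_right_mono) auto
    finally show ?thesis
      using s(1) by blast
  qed
  obtain s2 s3 where s2: "((\<lambda>i. frag 2 h \<alpha> \<beta> f i * \<phi> i) has_sum s2) {1..}" "s2 \<le> 1 / 8 * (\<Phi> + D)"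
    and s3: "((\<lambda>i. frag 3 h \<alpha> \<beta> f i * \<phi> i) has_sum s3) {1..}" "s3 \<le> 1 / 8 * (\<Phi> + D)"
    using frag[of 2] frag[of 3] by auto
  have "((\<lambda>i. coag h \<alpha> \<beta> f i * \<phi> i + frag 2 h \<alpha> \<beta> f i * \<phi> i + frag 3 h \<alpha> \<beta> f i * \<phi> i
      + - (f i * (real i * h) powr d * \<phi> i)) has_sum s1 + s2 + s3 + - D) {1..}"
    by (intro has_sum_add has_sum_uminusI s1(1) s2(1) s3(1) D)
  also have "(\<lambda>i. coag h \<alpha> \<beta> f i * \<phi> i + frag 2 h \<alpha> \<beta> f i * \<phi> i + frag 3 h \<alpha> \<beta> f i * \<phi> i
      + - (f i * (real i * h) powr d * \<phi> i)) = (\<lambda>i. rhs h \<alpha> \<beta> d f i * \<phi> i)"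
    by (simp add: rhs_def damp_def algebra_simps)
  finally have rhs: "(\<Sum>\<^sub>\<infinity>i\<in>{1..}. rhs h \<alpha> \<beta> d f i * \<phi> i) = s1 + s2 + s3 - D"
    by (simp add: infsumI)
  have AP: "A * P \<le> 1 / 2 * D + young A p d * \<Phi>"
  proof (rule has_sum_mono)
    show "((\<lambda>i. A * (f i * (real i * h) powr p * \<phi> i)) has_sum A * P) {1..}"
      by (intro has_sum_cmult_right P)
    show "((\<lambda>i. 1 / 2 * (f i * (real i * h) powr d * \<phi> i) + young A p d * (f i * \<phi> i)) has_sum
        1 / 2 * D + young A p d * \<Phi>) {1..}"
      by (intro has_sum_cmult_right has_sum_add D \<Phi>)
    fix i :: nat assume i: "i \<in> {1..}"
    have "A * (real i * h) powr p * (f i * \<phi> i)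
        \<le> (1 / 2 * (real i * h) powr d + young A p d) * (f i * \<phi> i)"
      using i h_pos pd A by (intro mult_right_mono powr_le_young) (auto simp: f_nonneg \<phi>_nonneg)
    then show "A * (f i * (real i * h) powr p * \<phi> i)
        \<le> 1 / 2 * (f i * (real i * h) powr d * \<phi> i) + young A p d * (f i * \<phi> i)"
      by (simp add: algebra_simps)
  qed
  have "2 powr (\<beta> 1 + 2) = 2 * A"
    by (simp add: A_def powr_add)
  \<comment> \<open>Here the smallness of the functional enters:
    \<open>2 * lam * \<Phi> \<le> 1\<close> makes the quadratic coagulation term linear.\<close>
  then have "2 powr (\<beta> 1 + 2) * lam * \<Phi> * P = (2 * lam * \<Phi>) * (A * P)"
    by simp
  also have "\<dots> \<le> 1 * (A * P)"
    using small par A nonneg by (intro mult_right_mono) (auto simp: \<Phi>_def field_simps)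
  finally have "s1 \<le> 1 / 2 * D + young A p d * \<Phi>"
    using s1(2) AP by linarith
  then have "s1 + s2 + s3 - D \<le> (young A p d + 1 / 4) * \<Phi> - 1 / 4 * D"
    using s2(2) s3(2) by (simp add: algebra_simps)
  then show ?thesis
    unfolding rhs \<Phi>_def D_def A_def p_def .
qed

text \<open>This is the quarter of the damping left over in \<open>rhs_cutoff_le\<close>.\<close>

lemma cutoff_dt_sum_le:
  assumes d: "1 \<le> d" "d \<le> \<kappa>" and par: "0 < lam" "lam \<le> 1 / 4" "0 \<le> t" "t \<le> 1" "0 < R" "R \<le> S"
  shows "(\<Sum>\<^sub>\<infinity>i\<in>{1..}. f i * (min (real i * h) S * weight_dt lam d t (min (real i * h) R)))
    \<le> 1 / 4 * (\<Sum>\<^sub>\<infinity>i\<in>{1..}. f i * (real i * h) powr d * cutoff lam d R S t (real i * h))"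
proof -
  let ?\<phi> = "\<lambda>i. cutoff lam d R S t (real i * h)"
  let ?\<psi> = "\<lambda>i. min (real i * h) S * weight_dt lam d t (min (real i * h) R)"
  have "\<bar>?\<phi> i\<bar> \<le> S * weight lam d 1 R" for i
    using cutoff_nonneg[of "real i * h" S lam d R t] h_pos d par by (auto intro!: cutoff_le)
  then have "(\<lambda>i. f i * (real i * h) powr d * ?\<phi> i) summable_on {1..}"
    using d by (intro weighted_moment_summable) auto
  then have D: "((\<lambda>i. 1 / 4 * (f i * (real i * h) powr d * ?\<phi> i)) has_sum
      1 / 4 * (\<Sum>\<^sub>\<infinity>i\<in>{1..}. f i * (real i * h) powr d * ?\<phi> i)) {1..}"
    by (intro has_sum_cmult_right) simp
  have le: "f i * ?\<psi> i \<le> 1 / 4 * (f i * (real i * h) powr d * ?\<phi> i)" if "i \<in> {1..}" for i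
  proof -
    have "f i * ?\<psi> i \<le> f i * (1 / 4 * ((real i * h) powr d * ?\<phi> i))"
      using that h_pos d par by (intro mult_left_mono cutoff_dt_le) (auto simp: f_nonneg)
    then show ?thesis
      by (simp add: ac_simps)
  qed
  have "0 \<le> f i * ?\<psi> i" if "i \<in> {1..}" for i
    using that h_pos d par by (auto simp: f_nonneg weight_dt_def weight_def intro!: mult_nonneg_nonneg)
  then have "(\<lambda>i. f i * ?\<psi> i) summable_on {1..}"
    by (intro summable_on_comparison_test[OF has_sum_imp_summable[OF D] le])
  then show ?thesis
    by (intro has_sum_mono[OF has_sum_infsum D le])
qed

end

section \<open>The differential inequality in time\<close>

lemma has_sum_eventually_const_weight:
  fixes u b :: "nat \<Rightarrow> real"
  assumes "u summable_on {1..}" "\<And>i. i > n \<Longrightarrow> b i = c"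
  shows "((\<lambda>i. u i * b i) has_sum (c * (\<Sum>\<^sub>\<infinity>i\<in>{1..}. u i) + (\<Sum>i=1..n. u i * (b i - c)))) {1..}"
proof -
  have "((\<lambda>i. u i * (b i - c)) has_sum (\<Sum>i=1..n. u i * (b i - c))) {1..}"
    by (rule has_sum_finite_neutralI[of "{1..n}"]) (use assms(2) in force)+
  then have "((\<lambda>i. c * u i + u i * (b i - c)) has_sum
      (c * (\<Sum>\<^sub>\<infinity>i\<in>{1..}. u i) + (\<Sum>i=1..n. u i * (b i - c)))) {1..}"
    by (intro has_sum_add has_sum_cmult_right has_sum_infsum assms(1))
  then show ?thesis
    by (simp add: algebra_simps)
qed

text \<open>Since the weights agree for all indices above \<open>n\<close>, the sum is a
  time-dependent constant times the total sum plus a finite correction. The product rule applies to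
  each piece, with no interchange of limits for moving weights.\<close>

lemma l1_C1_deriv_time_weighted_sum:
  fixes f g \<phi> :: "real \<Rightarrow> nat \<Rightarrow> real"
  assumes fg: "l1_C1_deriv f g" and X: "0 \<le> t0" "X \<subseteq> {0..}" "s \<in> X"
    and \<phi>: "\<And>i. i \<ge> 1 \<Longrightarrow> ((\<lambda>r. \<phi> r i) has_real_derivative \<phi>' i) (at s within X)"
    and const: "\<And>i r. r \<in> X \<Longrightarrow> i > n \<Longrightarrow> \<phi> r i = \<phi> r (Suc n)" "\<And>i. i > n \<Longrightarrow> \<phi>' i = \<phi>' (Suc n)"
  shows "((\<lambda>r. \<Sum>\<^sub>\<infinity>i\<in>{1..}. f (t0 + r) i * \<phi> r i) has_real_derivative
      (\<Sum>\<^sub>\<infinity>i\<in>{1..}. g (t0 + s) i * \<phi> s i) + (\<Sum>\<^sub>\<infinity>i\<in>{1..}. f (t0 + s) i * \<phi>' i)) (at s within X)"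
proof -
  have summable: "f r summable_on {1..}" "g r summable_on {1..}" if "r \<ge> 0" for r
    using fg that by (simp_all add: l1_C1_deriv_def in_l1_def Infinite_Sum.abs_summable_summable)
  have nonneg: "0 \<le> t0 + r" if "r \<in> X" for r
    using X that by auto
  \<comment> \<open>Bound 1 suffices because only the constant sequence and indicators of single
    indices are used.\<close>
  have shift: "((\<lambda>r. \<Sum>\<^sub>\<infinity>i\<in>{1..}. f (t0 + r) i * b i) has_real_derivative
      (\<Sum>\<^sub>\<infinity>i\<in>{1..}. g (t0 + s) i * b i)) (at s within X)" if "\<And>i. i \<ge> 1 \<Longrightarrow> \<bar>b i\<bar> \<le> 1" for b
  proof -
    have "((\<lambda>r. \<Sum>\<^sub>\<infinity>i\<in>{1..}. f r i * b i) has_real_derivative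
        (\<Sum>\<^sub>\<infinity>i\<in>{1..}. g (t0 + s) i * b i)) (at (t0 + s) within (\<lambda>r. t0 + r) ` X)"
      by (rule DERIV_subset[OF l1_C1_deriv_weighted_sum[OF fg nonneg[OF X(3)] that]])
        (use nonneg in auto)
    moreover have "((\<lambda>r. t0 + r) has_real_derivative 1) (at s within X)"
      by (auto intro!: derivative_eq_intros)
    ultimately show ?thesis
      using DERIV_image_chain by (fastforce simp: o_def)
  qed
  have total: "((\<lambda>r. \<Sum>\<^sub>\<infinity>i\<in>{1..}. f (t0 + r) i) has_real_derivative (\<Sum>\<^sub>\<infinity>i\<in>{1..}. g (t0 + s) i)) (at s within X)"
    using shift[of "\<lambda>_. 1"] by simp
  have single: "((\<lambda>r. f (t0 + r) j) has_real_derivative g (t0 + s) j) (at s within X)" if "j \<ge> 1" for j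
  proof -
    have "(\<Sum>\<^sub>\<infinity>i\<in>{1..}. u i * of_bool (i = j)) = (u j :: real)" for u
      using that by (intro infsumI has_sum_finite_neutralI[of "{j}"]) auto
    then show ?thesis
      using shift[of "\<lambda>i. of_bool (i = j)"] by simp
  qed
  let ?F = "\<lambda>r. \<phi> r (Suc n) * (\<Sum>\<^sub>\<infinity>i\<in>{1..}. f (t0 + r) i)
    + (\<Sum>i=1..n. f (t0 + r) i * (\<phi> r i - \<phi> r (Suc n)))"
  let ?D = "\<phi>' (Suc n) * (\<Sum>\<^sub>\<infinity>i\<in>{1..}. f (t0 + s) i) + (\<Sum>\<^sub>\<infinity>i\<in>{1..}. g (t0 + s) i) * \<phi> s (Suc n)
    + (\<Sum>i=1..n. g (t0 + s) i * (\<phi> s i - \<phi> s (Suc n)) + (\<phi>' i - \<phi>' (Suc n)) * f (t0 + s) i)"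
  have F: "(?F has_real_derivative ?D) (at s within X)"
    by (intro DERIV_add DERIV_mult DERIV_sum DERIV_diff \<phi> total single) auto
  have D: "?D = (\<Sum>\<^sub>\<infinity>i\<in>{1..}. g (t0 + s) i * \<phi> s i) + (\<Sum>\<^sub>\<infinity>i\<in>{1..}. f (t0 + s) i * \<phi>' i)"
  proof -
    have "(\<Sum>\<^sub>\<infinity>i\<in>{1..}. g (t0 + s) i * \<phi> s i) = \<phi> s (Suc n) * (\<Sum>\<^sub>\<infinity>i\<in>{1..}. g (t0 + s) i)
        + (\<Sum>i=1..n. g (t0 + s) i * (\<phi> s i - \<phi> s (Suc n)))"
      by (intro infsumI has_sum_eventually_const_weight summable nonneg const(1) X(3))
    moreover have "(\<Sum>\<^sub>\<infinity>i\<in>{1..}. f (t0 + s) i * \<phi>' i) = \<phi>' (Suc n) * (\<Sum>\<^sub>\<infinity>i\<in>{1..}. f (t0 + s) i)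
        + (\<Sum>i=1..n. f (t0 + s) i * (\<phi>' i - \<phi>' (Suc n)))"
      by (intro infsumI has_sum_eventually_const_weight summable nonneg const(2) X(3))
    ultimately show ?thesis
      by (simp add: sum.distrib mult.commute)
  qed
  have eq: "?F r = (\<Sum>\<^sub>\<infinity>i\<in>{1..}. f (t0 + r) i * \<phi> r i)" if "r \<in> X" for r
    using that by (intro infsumI[symmetric] has_sum_eventually_const_weight summable nonneg const(1))
  show ?thesis
    by (rule has_field_derivative_transform_within[OF F[unfolded D] zero_less_one X(3) eq])
qed

text \<open>The first entry serves \<open>weight_dt_le\<close>; the second makes the Gronwall bound
  over unit time, started from \<open>exp 1 * m\<close>, smaller than \<open>1 / (2 * lam)\<close>.
  The form \<open>\<bar>m\<bar> + 1\<close> keeps the value positive for every real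
  \<open>m\<close>.\<close>

definition smallness :: "real \<Rightarrow> real \<Rightarrow> real \<Rightarrow> real \<Rightarrow> real" where
  "smallness m a b d = min (1 / 4)
     (1 / (2 * exp (1 + (young (2 powr (b + 1)) (2 * a + b) d + 1 / 4)) * (\<bar>m\<bar> + 1)))"

lemma smallness_pos: "0 < smallness m a b d"
  by (simp add: smallness_def add_nonneg_pos)

lemma smallness_D:
  assumes "0 < lam" "lam < smallness m a b d" "0 \<le> m"
  shows "lam \<le> 1 / 4"
    and "exp 1 * m * exp (young (2 powr (b + 1)) (2 * a + b) d + 1 / 4) < 1 / (2 * lam)"
proof -
  let ?e = "exp (1 + (young (2 powr (b + 1)) (2 * a + b) d + 1 / 4))"
  have *: "lam < 1 / 4" "lam < 1 / (2 * ?e * (m + 1))"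
    using assms unfolding smallness_def by auto
  then show "lam \<le> 1 / 4" by simp
  have "lam * (2 * ?e * (m + 1)) < 1"
    using * assms by (simp add: pos_less_divide_eq)
  then have "?e * (m + 1) < 1 / (2 * lam)"
    using assms by (simp add: pos_less_divide_eq ac_simps)
  moreover have "?e * m \<le> ?e * (m + 1)"
    by simp
  moreover have "exp 1 * m * exp (young (2 powr (b + 1)) (2 * a + b) d + 1 / 4) = ?e * m"
    by (simp only: exp_add ac_simps)
  ultimately show "exp 1 * m * exp (young (2 powr (b + 1)) (2 * a + b) d + 1 / 4) < 1 / (2 * lam)"
    by linarith
qed

section \<open>Exponential moments of a solution\<close>

lemma solution_moment_slice:
  assumes "solution h \<alpha> \<beta> \<delta> \<kappa> f0 f" "0 < h" "0 \<le> t"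
  shows "moment_slice h \<kappa> (f t)"
proof
  show "f t summable_on {1..}"
    using assms by (simp add: solution_def l1_C1_deriv_def in_l1_def Infinite_Sum.abs_summable_summable)
qed (use assms in \<open>auto simp: solution_def finite_moment_def\<close>)

text \<open>Finite partial sums only see a truncated weight, and the bound does not depend on the
  truncation. The starting time \<open>t0\<close> is free so that the estimate can be
  restarted.\<close>

lemma exponential_moment_partial_sum_le:
  assumes adm: "admissible h \<alpha> \<beta> \<delta>" and p: "2 * \<alpha> 1 + \<beta> 1 < \<delta>" and \<delta>: "1 \<le> \<delta>" "\<delta> < \<kappa>"
    and sol: "solution h \<alpha> \<beta> \<delta> \<kappa> f0 f" and m: "0 \<le> moment h 1 f0"
    and lam: "0 < lam" "lam < smallness (moment h 1 f0) (\<alpha> 1) (\<beta> 1) \<delta>"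
    and t: "0 \<le> t0" "0 \<le> t" "t \<le> 1" and F: "finite F" "F \<subseteq> {1..}"
  shows "(\<Sum>i\<in>F. f (t0 + t) i * (real i * h) * exp (lam * t powr (1 / \<delta>) * (real i * h))) \<le> 1 / (2 * lam)"
proof -
  have h: "0 < h"
    using adm by (simp add: admissible_def)
  have ab: "0 < \<alpha> n \<and> 0 < \<beta> n \<and> \<alpha> n + \<beta> n \<le> \<delta>" if "n \<in> {1, 2, 3}" for n
    using adm that by (auto simp: admissible_def)
  have slice: "moment_slice h \<kappa> (f s)" if "0 \<le> s" for s
    using solution_moment_slice[OF sol h that] .
  note lam4 = smallness_D[OF lam m]
  \<comment> \<open>A bound on the high moment that is uniform in time, so that one choice of
    \<open>S\<close> serves the whole interval.\<close>
  define M where "M = max (moment h \<kappa> f0) (2 * B_bound \<alpha> \<beta> \<delta> \<kappa> (moment h 1 f0))"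
  have M: "moment h \<kappa> (f s) \<le> M" if "0 \<le> s" for s
    using sol that by (simp add: solution_def M_def)
  obtain N where N: "F \<subseteq> {..<N}"
    using finite_nat_bounded[OF F(1)] by blast
  \<comment> \<open>\<open>R\<close> lies beyond all sizes in \<open>F\<close>, where the truncation
    therefore changes nothing.\<close>
  define R where "R = real (Suc N) * h"
  have R_ge: "real i * h \<le> R" if "i \<in> F" for i
    using h N that by (auto simp: R_def intro!: mult_right_mono)
  have R: "0 < R"
    using h by (simp add: R_def)
  let ?W = "weight lam \<delta> 1 R"
  \<comment> \<open>With \<open>R\<close> fixed, \<open>?W\<close> is a constant, and the exponent
    of \<open>S\<close> is negative because
    \<open>\<alpha> n + \<beta> n \<le> \<delta> < \<kappa>\<close>.\<close>
  have lim: "\<forall>\<^sub>F S in at_top. ?W * (S powr (\<alpha> n + \<beta> n - \<kappa>) * M) < 1 / 8" if n: "n \<in> {2, 3}" for n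
  proof -
    have "((\<lambda>S. S powr (\<alpha> n + \<beta> n - \<kappa>)) \<longlongrightarrow> 0) at_top"
      using ab[of n] n \<delta> by (intro tendsto_neg_powr filterlim_ident) auto
    then have "((\<lambda>S. ?W * (S powr (\<alpha> n + \<beta> n - \<kappa>) * M)) \<longlongrightarrow> ?W * (0 * M)) at_top"
      by (intro tendsto_intros)
    then show ?thesis
      by (rule order_tendstoD(2)) simp
  qed
  have "\<forall>\<^sub>F S in at_top. R \<le> S \<and> (\<forall>n\<in>{2, 3}. ?W * (S powr (\<alpha> n + \<beta> n - \<kappa>) * M) < 1 / 8)"
    using lim by (intro eventually_conj eventually_ge_at_top eventually_ball_finite) auto
  then obtain S where S: "R \<le> S" "\<And>n. n \<in> {2, 3} \<Longrightarrow> ?W * (S powr (\<alpha> n + \<beta> n - \<kappa>) * M) < 1 / 8"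
    by (auto dest!: eventually_happens' [OF trivial_limit_at_top_linorder])
  have S': "?W * (S powr (\<alpha> n + \<beta> n - \<kappa>) * moment h \<kappa> (f s)) \<le> 1 / 8"
    if "n \<in> {2, 3}" "0 \<le> s" for n s
  proof -
    have "?W * (S powr (\<alpha> n + \<beta> n - \<kappa>) * moment h \<kappa> (f s)) \<le> ?W * (S powr (\<alpha> n + \<beta> n - \<kappa>) * M)"
      using M[OF that(2)] by (intro mult_left_mono) (auto simp: weight_def)
    with S(2)[OF that(1)] show ?thesis by linarith
  qed
  define \<phi> where "\<phi> = (\<lambda>s i. cutoff lam \<delta> R S s (real i * h))"
  define \<phi>' where "\<phi>' = (\<lambda>s i. min (real i * h) S * weight_dt lam \<delta> s (min (real i * h) R))"
  \<comment> \<open>Every index above \<open>n\<close> has size at least \<open>S\<close>, where the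
    cutoff is constant.\<close>
  define n where "n = nat \<lceil>S / h\<rceil>"
  have large: "S \<le> real i * h" if "n < i" for i
  proof -
    have "S / h \<le> real i"
      using that by (simp add: n_def) linarith
    then show ?thesis
      using h by (simp add: pos_divide_le_eq)
  qed
  have \<phi>_nonneg: "0 \<le> \<phi> s i" for s i
    using h R S by (auto simp: \<phi>_def intro!: cutoff_nonneg)
  have \<phi>_bound: "\<bar>\<phi> s i\<bar> \<le> S * ?W" if "0 \<le> s" "s \<le> 1" for s i
    using \<phi>_nonneg[of s i] that h R S \<delta> lam by (auto simp: \<phi>_def intro!: cutoff_le)
  define u where "u = (\<lambda>s. \<Sum>\<^sub>\<infinity>i\<in>{1..}. f (t0 + s) i * \<phi> s i)"
  define u' where "u' = (\<lambda>s. (\<Sum>\<^sub>\<infinity>i\<in>{1..}. rhs h \<alpha> \<beta> \<delta> (f (t0 + s)) i * \<phi> s i)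
      + (\<Sum>\<^sub>\<infinity>i\<in>{1..}. f (t0 + s) i * \<phi>' s i))"
  define a where "a = young (2 powr (\<beta> 1 + 1)) (2 * \<alpha> 1 + \<beta> 1) \<delta> + 1 / 4"
  have u: "((\<lambda>i. f (t0 + s) i * \<phi> s i) has_sum u s) {1..}" if "0 \<le> s" "s \<le> 1" for s
    unfolding u_def using that t
    by (intro has_sum_infsum summable_on_mult_bounded[OF moment_slice.f_summable[OF slice] \<phi>_bound]) auto
  have f_nonneg: "0 \<le> f (t0 + s) i" if "0 \<le> s" "i \<ge> 1" for s i
    using sol t that by (simp add: solution_def)
  have deriv: "(u has_real_derivative u' s) (at s within {0..1})" if s: "0 \<le> s" "s \<le> 1" for s
    unfolding u_def u'_def
  proof (rule l1_C1_deriv_time_weighted_sum[where n = n])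
    show "l1_C1_deriv f (\<lambda>t. rhs h \<alpha> \<beta> \<delta> (f t))"
      using sol by (simp add: solution_def)
    show "((\<lambda>r. \<phi> r i) has_real_derivative \<phi>' s i) (at s within {0..1})" for i
      unfolding \<phi>_def \<phi>'_def using h lam \<delta> s R by (intro cutoff_has_time_derivative) auto
    show "\<phi> r i = \<phi> r (Suc n)" "\<phi>' s i = \<phi>' s (Suc n)" if "n < i" for r i
      using large[OF that] large[of "Suc n"] S(1)
      by (simp_all add: \<phi>_def \<phi>'_def cutoff_eventually_const min_absorb2)
  qed (use s t in auto)
  have le: "u' s \<le> a * u s" if s: "0 \<le> s" "s \<le> 1" and small: "u s \<le> 1 / (2 * lam)" for s
  proof -
    interpret moment_slice h \<kappa> "f (t0 + s)"
      using t s by (intro slice) auto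
    have "(\<Sum>\<^sub>\<infinity>i\<in>{1..}. rhs h \<alpha> \<beta> \<delta> (f (t0 + s)) i * \<phi> s i)
        \<le> a * u s - 1 / 4 * (\<Sum>\<^sub>\<infinity>i\<in>{1..}. f (t0 + s) i * (real i * h) powr \<delta> * \<phi> s i)"
      unfolding a_def u_def \<phi>_def
      by (rule rhs_cutoff_le[where \<alpha> = \<alpha> and \<beta> = \<beta>, OF ab p \<delta>(1) less_imp_le[OF \<delta>(2)] lam(1) s R S(1) S'
            small[unfolded u_def \<phi>_def]])
        (use t s in auto)
    moreover have "(\<Sum>\<^sub>\<infinity>i\<in>{1..}. f (t0 + s) i * \<phi>' s i)
        \<le> 1 / 4 * (\<Sum>\<^sub>\<infinity>i\<in>{1..}. f (t0 + s) i * (real i * h) powr \<delta> * \<phi> s i)"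
      unfolding \<phi>'_def \<phi>_def using \<delta> lam lam4 s R S(1) by (intro cutoff_dt_sum_le) auto
    ultimately show ?thesis
      by (simp add: u'_def)
  qed
  \<comment> \<open>At time 0 the weight equals \<open>exp 1\<close>, so only the first moment at
    \<open>t0\<close> enters, and this never exceeds the initial one.\<close>
  have "u 0 \<le> exp 1 * moment h 1 (f t0)"
  proof (rule has_sum_mono[OF u])
    have "finite_moment h 1 (f t0)"
      using sol t by (simp add: solution_def)
    then show "((\<lambda>i. exp 1 * (f t0 i * (real i * h) powr 1)) has_sum exp 1 * moment h 1 (f t0)) {1..}"
      unfolding moment_def finite_moment_def by (intro has_sum_cmult_right has_sum_infsum)
    fix i :: nat assume "i \<in> {1..}"
    then have "f t0 i * \<phi> 0 i \<le> f t0 i * (exp 1 * (real i * h))"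
      using h f_nonneg[of 0 i] unfolding \<phi>_def by (intro mult_left_mono cutoff_0_le) auto
    then show "f (t0 + 0) i * \<phi> 0 i \<le> exp 1 * (f t0 i * (real i * h) powr 1)"
      using h by (simp add: ac_simps)
  qed auto
  also have "\<dots> \<le> exp 1 * moment h 1 f0"
    using sol t by (intro mult_left_mono) (auto simp: solution_def)
  finally have "u 0 * exp (a * 1) \<le> exp 1 * moment h 1 f0 * exp a"
    by simp
  also have "\<dots> < 1 / (2 * lam)"
    using lam4(2) by (simp add: a_def)
  finally have init: "u 0 * exp (a * 1) < 1 / (2 * lam)" .
  have a: "0 \<le> a"
    by (simp add: a_def young_def)
  have u0: "0 \<le> u 0"
    using f_nonneg[of 0] \<phi>_nonneg by (intro has_sum_nonneg[OF u]) auto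
  have "u t < 1 / (2 * lam)"
    by (rule bootstrap_gronwall[OF deriv le init a u0 t(2,3)])
  moreover have "(\<Sum>i\<in>F. f (t0 + t) i * (real i * h) * exp (lam * t powr (1 / \<delta>) * (real i * h)))
      \<le> (\<Sum>i\<in>F. f (t0 + t) i * \<phi> t i)"
  proof (rule sum_mono)
    fix i assume i: "i \<in> F"
    then have "i \<ge> 1" using F(2) by auto
    moreover have "exp (lam * t powr (1 / \<delta>) * (real i * h)) \<le> weight lam \<delta> t (real i * h)"
      using lam \<delta> t h by (intro exp_le_weight) auto
    ultimately show "f (t0 + t) i * (real i * h) * exp (lam * t powr (1 / \<delta>) * (real i * h)) \<le> f (t0 + t) i * \<phi> t i"
      using R_ge[OF i] S(1) h f_nonneg[of t i] t
      by (simp add: \<phi>_def cutoff_eq mult.assoc mult_left_mono)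
  qed
  moreover have "(\<Sum>i\<in>F. f (t0 + t) i * \<phi> t i) \<le> u t"
    by (rule finite_sum_le_has_sum[OF u[OF t(2,3)] F]) (use f_nonneg t \<phi>_nonneg in auto)
  ultimately show ?thesis
    by linarith
qed

text \<open>Uniform bounds on partial sums of nonnegative terms give both summability and the bound.
  The free rate \<open>c\<close> covers the exponent with \<open>\<lfloor>\<delta>\<rfloor>\<close>
  as well as the full rate 1.\<close>

lemma exponential_moment_le:
  assumes adm: "admissible h \<alpha> \<beta> \<delta>" and p: "2 * \<alpha> 1 + \<beta> 1 < \<delta>" and \<delta>: "1 \<le> \<delta>" "\<delta> < \<kappa>"
    and sol: "solution h \<alpha> \<beta> \<delta> \<kappa> f0 f" and m: "0 \<le> moment h 1 f0"
    and lam: "0 < lam" "lam < smallness (moment h 1 f0) (\<alpha> 1) (\<beta> 1) \<delta>"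
    and t: "0 \<le> t0" "0 \<le> t" "t \<le> 1" and c: "c \<le> t powr (1 / \<delta>)"
  shows "(\<lambda>i. f (t0 + t) i * (real i * h) * exp (lam * c * (real i * h))) summable_on {1..} \<and>
    (\<Sum>\<^sub>\<infinity>i\<in>{1..}. f (t0 + t) i * (real i * h) * exp (lam * c * (real i * h))) \<le> 1 / (2 * lam)"
proof -
  let ?s = "\<lambda>i. f (t0 + t) i * (real i * h) * exp (lam * c * (real i * h))"
  have h: "0 < h"
    using adm by (simp add: admissible_def)
  have f_nonneg: "0 \<le> f (t0 + t) i" if "i \<ge> 1" for i
    using sol t that by (simp add: solution_def)
  have le: "sum ?s F \<le> 1 / (2 * lam)" if F: "finite F" "F \<subseteq> {1..}" for F
  proof -
    have "sum ?s F \<le> (\<Sum>i\<in>F. f (t0 + t) i * (real i * h) * exp (lam * t powr (1 / \<delta>) * (real i * h)))"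
      using F h lam c by (intro sum_mono mult_left_mono) (auto intro!: f_nonneg mult_right_mono mult_nonneg_nonneg simp: subset_iff)
    also have "\<dots> \<le> 1 / (2 * lam)"
      by (rule exponential_moment_partial_sum_le[OF adm p \<delta> sol m lam t F])
    finally show ?thesis .
  qed
  have "?s summable_on {1..}"
  proof (rule nonneg_bdd_above_summable_on)
    show "bdd_above (sum ?s ` {F. F \<subseteq> {1..} \<and> finite F})"
      using le by (intro bdd_aboveI2) auto
  qed (use h f_nonneg in auto)
  with infsum_le_finite_sums[OF this le] show ?thesis
    by blast
qed

text \<open>Summability is asserted beside each bound because a divergent infinite sum has the value
  0, which would satisfy the bound trivially.\<close>

theorem theorem2p14:
  "\<exists>\<Lambda> :: real \<Rightarrow> real \<Rightarrow> real \<Rightarrow> real \<Rightarrow> real.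
     (\<forall>m a b d. 0 < \<Lambda> m a b d) \<and>
     (\<forall>(h::real) (\<alpha> :: nat \<Rightarrow> real) (\<beta> :: nat \<Rightarrow> real) (\<delta>::real) (\<kappa>::real)
        (f0 :: nat \<Rightarrow> real) (f :: real \<Rightarrow> nat \<Rightarrow> real).
        admissible h \<alpha> \<beta> \<delta> \<longrightarrow>
        \<delta> > 2 * \<alpha> 1 + \<beta> 1 \<longrightarrow>
        \<delta> \<ge> 1 \<longrightarrow>
        \<kappa> > Max {\<delta>, 1, 2 - \<alpha> 1 - \<beta> 1} \<longrightarrow>
        (\<forall>i\<ge>1. 0 \<le> f0 i) \<longrightarrow>
        finite_moment h \<kappa> f0 \<longrightarrow>
        solution h \<alpha> \<beta> \<delta> \<kappa> f0 f \<longrightarrow>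
        (\<forall>lam::real. 0 < lam \<and> lam < \<Lambda> (moment h 1 f0) (\<alpha> 1) (\<beta> 1) \<delta> \<longrightarrow>
           (\<forall>t\<in>{0..1}.
              (\<lambda>i. f t i * (real i * h) * exp (lam * t powr (1 / of_int \<lfloor>\<delta>\<rfloor>) * (real i * h)))
                summable_on {1..} \<and>
              (\<Sum>\<^sub>\<infinity>i\<in>{1..}.
                 f t i * (real i * h) * exp (lam * t powr (1 / of_int \<lfloor>\<delta>\<rfloor>) * (real i * h)))
                \<le> 1 / (2 * lam)) \<and>
           (\<forall>t\<in>{1..}.
              (\<lambda>i. f t i * (real i * h) * exp (lam * (real i * h))) summable_on {1..} \<and>
              (\<Sum>\<^sub>\<infinity>i\<in>{1..}. f t i * (real i * h) * exp (lam * (real i * h)))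
                \<le> 1 / (2 * lam))))"
proof (intro exI[of _ smallness] conjI allI impI ballI)
  show "0 < smallness m a b d" for m a b d
    by (rule smallness_pos)
next
  fix h :: real and \<alpha> \<beta> :: "nat \<Rightarrow> real" and \<delta> \<kappa> :: real
    and f0 :: "nat \<Rightarrow> real" and f :: "real \<Rightarrow> nat \<Rightarrow> real" and lam t :: real
  assume adm: "admissible h \<alpha> \<beta> \<delta>" and p: "2 * \<alpha> 1 + \<beta> 1 < \<delta>" and \<delta>: "1 \<le> \<delta>"
    and \<kappa>: "\<kappa> > Max {\<delta>, 1, 2 - \<alpha> 1 - \<beta> 1}" and f0: "\<forall>i\<ge>1. 0 \<le> f0 i"
    and sol: "solution h \<alpha> \<beta> \<delta> \<kappa> f0 f"
    and lam: "0 < lam \<and> lam < smallness (moment h 1 f0) (\<alpha> 1) (\<beta> 1) \<delta>"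
  have m: "0 \<le> moment h 1 f0"
    unfolding moment_def using f0 by (intro infsum_nonneg) auto
  have "\<delta> < \<kappa>"
    using \<kappa> by simp
  note bound = exponential_moment_le[OF adm p \<delta> this sol m conjunct1[OF lam] conjunct2[OF lam]]
  {
    assume t: "t \<in> {0..1}"
    \<comment> \<open>Since \<open>\<lfloor>\<delta>\<rfloor> \<le> \<delta>\<close> and
      \<open>t \<le> 1\<close>, the larger exponent gives the smaller power; at \<open>t = 0\<close>
      both powers are 0.\<close>
    have "t powr (1 / of_int \<lfloor>\<delta>\<rfloor>) \<le> t powr (1 / \<delta>)"
    proof (cases "t = 0")
      case False
      have "0 < real_of_int \<lfloor>\<delta>\<rfloor>"
        using \<delta> by simp
      then show ?thesis
        using t False \<delta> by (intro powr_mono' divide_left_mono) auto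
    qed simp
    note c = bound[of 0 t, OF _ _ _ this]
    show "(\<lambda>i. f t i * (real i * h) * exp (lam * t powr (1 / of_int \<lfloor>\<delta>\<rfloor>) * (real i * h))) summable_on {1..}"
      "(\<Sum>\<^sub>\<infinity>i\<in>{1..}. f t i * (real i * h) * exp (lam * t powr (1 / of_int \<lfloor>\<delta>\<rfloor>) * (real i * h))) \<le> 1 / (2 * lam)"
      using c t by simp_all
  next
    assume t: "t \<in> {1..}"
    show "(\<lambda>i. f t i * (real i * h) * exp (lam * (real i * h))) summable_on {1..}"
      "(\<Sum>\<^sub>\<infinity>i\<in>{1..}. f t i * (real i * h) * exp (lam * (real i * h))) \<le> 1 / (2 * lam)"
      \<comment> \<open>Restart at time \<open>t - 1\<close> and run for unit time, at the end of
        which the full rate is available.\<close>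
      using bound[of "t - 1" 1 1] t by simp_all
  }
qed

end
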